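(* There is a constant $c>0$ such that for all $d\in\mathbb{N}$ and all $\varepsilon\in(0,1/2)$, \[ n(\varepsilon,F_d^{\log},L_2)\,\le\, c\,d\,\varepsilon^{-3}\log^3(\varepsilon^{-1}). \]
   Context: For $f\in C([0,1]^d)$ (continuous, complex-valued) and $k\in\mathbb{Z}^d$, let $\hat f(k)=\int_{[0,1]^d} f(x)e^{-2\pi i\langle k,x\rangle}\,dx$. Define the function class \[ F_d^{\log}:=\Big\{f\in C([0,1]^d)\ \Big|\ \sum_{k\in\mathbb{Z}^d}|\hat f(k)|\max(1,\log\|k\|_\infty)\le 1\Big\}, \] where the factor $\max(1,\log\|k\|_\infty)$ equals $1$ for $k=0$. A sampling algorithm with $n$ points on a class $F_d$ of functions on $[0,1]^d$ is a map $A_n\colon F_d\to L_2([0,1]^d)$ of the form $A_n(f)=\phi(f(x_1),\dots,f(x_n))$ with sampling points $x_1,\dots,x_n\in[0,1]^d$ and an arbitrary (possibly non-linear) recovery map $\phi\colon\mathbb{C}^n\to L_2([0,1]^d)$. Its worst-case error is $\mathrm{err}(A_n,F_d,L_2):=\sup_{f\in F_d}\|f-A_n(f)\|_2$. The (information) complexity is \[ n(\varepsilon,F_d,L_2):=\min\{n\in\mathbb{N}\mid \exists A_n\colon \mathrm{err}(A_n,F_d,L_2)\le\varepsilon\}, \] where $A_n$ ranges over all sampling algorithms with $n$ points. *)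

theory Defs
  imports "HOL-Probability.Probability"
begin

text \<open>
  The dimension is quantified inside the statement, so points of \<open>\<real>\<^sup>d\<close> (and likewise vectors in
  \<open>\<int>\<^sup>d\<close> and \<open>\<complex>\<^sup>n\<close>) are functions on \<open>nat\<close> that are extensional on \<open>{..<d}\<close>.
  On such functions the product topology of \<open>nat \<Rightarrow> real\<close> is the Euclidean topology.
\<close>

definition unit_cube :: "nat \<Rightarrow> (nat \<Rightarrow> real) set" where
  "unit_cube d = (\<Pi>\<^sub>E i\<in>{..<d}. {0..1})"

definition cube_measure :: "nat \<Rightarrow> (nat \<Rightarrow> real) measure" where
  "cube_measure d = (\<Pi>\<^sub>M i\<in>{..<d}. restrict_space lborel {0..1})"

definition int_vectors :: "nat \<Rightarrow> (nat \<Rightarrow> int) set" where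
  "int_vectors d = (\<Pi>\<^sub>E i\<in>{..<d}. UNIV)"

definition complex_vectors :: "nat \<Rightarrow> (nat \<Rightarrow> complex) set" where
  "complex_vectors n = (\<Pi>\<^sub>E i\<in>{..<n}. UNIV)"

definition fourier_coeff :: "nat \<Rightarrow> ((nat \<Rightarrow> real) \<Rightarrow> complex) \<Rightarrow> (nat \<Rightarrow> int) \<Rightarrow> complex" where
  "fourier_coeff d f k =
     (LINT x|cube_measure d.
        f x * exp (- 2 * of_real pi * \<i> * of_real (\<Sum>i<d. of_int (k i) * x i)))"

text \<open>Used only for \<open>d \<ge> 1\<close>, where the maximum is over a nonempty set.\<close>

definition sup_norm :: "nat \<Rightarrow> (nat \<Rightarrow> int) \<Rightarrow> int" where
  "sup_norm d k = Max ((\<lambda>i. \<bar>k i\<bar>) ` {..<d})"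

definition log_weight :: "nat \<Rightarrow> (nat \<Rightarrow> int) \<Rightarrow> real" where
  "log_weight d k = (if sup_norm d k = 0 then 1 else max 1 (ln (of_int (sup_norm d k))))"

text \<open>
  Elements of \<open>C([0,1]\<^sup>d)\<close> are represented by total functions whose values outside the cube are
  irrelevant. Summability is required explicitly because \<open>infsum\<close> is \<open>0\<close> on divergent families.
\<close>

definition F_log :: "nat \<Rightarrow> ((nat \<Rightarrow> real) \<Rightarrow> complex) set" where
  "F_log d = {f. continuous_on (unit_cube d) f \<and>
      (\<lambda>k. cmod (fourier_coeff d f k) * log_weight d k) summable_on int_vectors d \<and>
      (\<Sum>\<^sub>\<infinity>k\<in>int_vectors d. cmod (fourier_coeff d f k) * log_weight d k) \<le> 1}"

text \<open>
  \<open>L\<^sub>2([0,1]\<^sup>d)\<close> by representatives rather than by classes modulo null sets.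
\<close>

definition L2_cube :: "nat \<Rightarrow> ((nat \<Rightarrow> real) \<Rightarrow> complex) set" where
  "L2_cube d = {g \<in> borel_measurable (cube_measure d).
      integrable (cube_measure d) (\<lambda>x. (cmod (g x))\<^sup>2)}"

definition L2_norm_cube :: "nat \<Rightarrow> ((nat \<Rightarrow> real) \<Rightarrow> complex) \<Rightarrow> real" where
  "L2_norm_cube d g = sqrt (LINT x|cube_measure d. (cmod (g x))\<^sup>2)"

definition sampling_algorithm ::
  "nat \<Rightarrow> nat \<Rightarrow> ((nat \<Rightarrow> real) \<Rightarrow> complex) set \<Rightarrow>
   (((nat \<Rightarrow> real) \<Rightarrow> complex) \<Rightarrow> ((nat \<Rightarrow> real) \<Rightarrow> complex)) \<Rightarrow> bool" where
  "sampling_algorithm d n F A \<longleftrightarrow>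
     (\<exists>x \<phi>. (\<forall>i<n. x i \<in> unit_cube d) \<and>
            (\<forall>y\<in>complex_vectors n. \<phi> y \<in> L2_cube d) \<and>
            (\<forall>f\<in>F. A f = \<phi> (\<lambda>i\<in>{..<n}. f (x i))))"

definition worst_case_error ::
  "nat \<Rightarrow> ((nat \<Rightarrow> real) \<Rightarrow> complex) set \<Rightarrow>
   (((nat \<Rightarrow> real) \<Rightarrow> complex) \<Rightarrow> ((nat \<Rightarrow> real) \<Rightarrow> complex)) \<Rightarrow> ennreal" where
  "worst_case_error d F A = (SUP f\<in>F. ennreal (L2_norm_cube d (\<lambda>x. f x - A f x)))"

text \<open>
  Here \<open>\<nat> = {1, 2, \<dots>}\<close>; the value is \<open>\<infinity>\<close> if no number of points suffices.
\<close>

definition complexity :: "real \<Rightarrow> nat \<Rightarrow> ((nat \<Rightarrow> real) \<Rightarrow> complex) set \<Rightarrow> enat" where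
  "complexity \<epsilon> d F =
     Inf {enat n | n. 1 \<le> n \<and>
       (\<exists>A. sampling_algorithm d n F A \<and> worst_case_error d F A \<le> ennreal \<epsilon>)}"

end

theory Submission
  imports Defs
begin

text \<open>
  Sampling at \<open>x\<^sub>1, \<dots>, x\<^sub>n\<close> and returning any member of the class that interpolates the data is
  accurate as soon as every difference \<open>h = f - g\<close> of two members that vanishes at all the
  points has a small \<open>L\<^sub>2\<close> norm. So the task is to find few points that detect every \<open>h\<close> of large
  norm whose log-weighted Fourier coefficients have sum at most \<open>2\<close>.

  Frequencies above a cutoff \<open>m\<close> with \<open>ln m\<close> of order \<open>1 / \<epsilon>\<close> carry total coefficient mass \<open>O(\<epsilon>)\<close>, hence contribute
  \<open>O(\<epsilon>)\<close> in the sup norm (\<open>dist_partial_fourier_sum\<close>). This step needs a pointwise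
  estimate by Fourier coefficients on the closed, non-periodic cube, which is obtained from a product
  kernel with a Korovkin argument (\<open>norm_le_fourier_sum\<close>). What remains is a trigonometric
  polynomial \<open>q\<close> over a dictionary of \<open>K\<close> real characters with \<open>ln K = O(d / \<epsilon>)\<close> and coefficients
  that are bounded in \<open>\<ell>\<^sub>1\<close>.

  For such \<open>q\<close> the argument works level by level. If \<open>q\<close> has \<open>L\<^sub>2\<close> norm about \<open>\<epsilon> \<approx> 2\<^bsup>-J\<^esup>\<close>, then for
  some \<open>j \<le> J\<close> the set where \<open>\<bar>q\<bar>\<close> exceeds \<open>2\<^bsup>-j\<^esup>\<close> has measure at least \<open>4\<^bsup>j-J\<^esup> / (4 J)\<close>
  (\<open>exists_large_level\<close>). At that level \<open>q\<close> may be replaced by an average of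
  \<open>m\<^sub>j = O(4\<^sup>j J)\<close> dictionary elements, which by Hoeffding's inequality is \<open>2\<^bsup>-j\<^esup> / 4\<close>-close to \<open>q\<close>
  except on an exponentially small fraction of the cube and also of the sample points
  (\<open>exists_tuple_average\<close>). There are at most \<open>K\<^bsup>m\<^sub>j\<^esup>\<close> averages, and by a union bound one choice
  of \<open>n\<close> points meets the large set of each of them about as often as expected
  (\<open>exists_hitting_points\<close>). Few terms suffice when \<open>j\<close> is small, the large sets have large
  measure when \<open>j\<close> is large, and the two effects cancel: for each \<open>j\<close> the requirement is
  \<open>n \<ge> C J\<^sup>2 4\<^sup>J ln K\<close> (\<open>exists_detecting_points\<close>). Since \<open>4\<^sup>J = O(\<epsilon>\<^bsup>-2\<^esup>)\<close> and
  \<open>J = O(ln (1 / \<epsilon>))\<close>, this is \<open>O(d \<epsilon>\<^bsup>-3\<^esup> ln\<^sup>2 (1 / \<epsilon>))\<close>.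
\<close>

section \<open>Points that hit finitely many sets often\<close>

lemma (in prob_space) exists_le_integral:
  fixes f :: "'a \<Rightarrow> real"
  assumes f: "integrable M f"
  shows "\<exists>x\<in>space M. f x \<le> (LINT x|M. f x)"
proof (rule ccontr)
  assume "\<not> ?thesis"
  then have "AE x in M. (LINT x|M. f x) < f x" by (force intro!: AE_I2)
  from expectation_greater[OF f this] show False by simp
qed

text \<open>
  The method of conditional expectations: averaging over one more point multiplies the summand of
  \<open>B i\<close> by \<open>1 - prob (B i) / 2\<close>, so some value of that point does at least as well. The product on the
  left-hand side is \<open>2\<^bsup>-Z\<^esup>\<close> for the number \<open>Z\<close> of hits of \<open>B i\<close>.
\<close>

lemma (in prob_space) exists_points_small_potential:
  fixes v :: "'i \<Rightarrow> real"
  assumes I: "finite I" and B: "\<And>i. i \<in> I \<Longrightarrow> B i \<in> sets M"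
    and v: "\<And>i. i \<in> I \<Longrightarrow> 0 \<le> v i"
  shows "\<exists>x. (\<forall>l<n. x l \<in> space M) \<and>
    (\<Sum>i\<in>I. v i * (\<Prod>l<n. 1 - indicator (B i) (x l) / 2)) \<le> (\<Sum>i\<in>I. v i * (1 - prob (B i) / 2) ^ n)"
  using v
proof (induction n arbitrary: v)
  case 0
  show ?case by simp
next
  case (Suc n)
  define w where "w i = v i * (1 - prob (B i) / 2)" for i
  have "0 \<le> w i" if "i \<in> I" for i
    unfolding w_def by (rule mult_nonneg_nonneg[OF Suc.prems[OF that]]) (use prob_le_1[of "B i"] in linarith)
  from Suc.IH[of w, OF this] obtain x where x: "\<forall>l<n. x l \<in> space M"
    and le: "(\<Sum>i\<in>I. w i * (\<Prod>l<n. 1 - indicator (B i) (x l) / 2)) \<le> (\<Sum>i\<in>I. w i * (1 - prob (B i) / 2) ^ n)"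
    by blast
  define F where "F y = (\<Sum>i\<in>I. v i * (\<Prod>l<n. 1 - indicator (B i) (x l) / 2) * (1 - indicator (B i) y / 2))" for y
  have int: "integrable M (\<lambda>y. 1 - indicator (B i) y / 2 :: real)" if "i \<in> I" for i
    using B[OF that] by (intro Bochner_Integration.integrable_diff integrable_const Bochner_Integration.integrable_divide)
      (auto simp: less_top[symmetric])
  have F: "integrable M F"
    unfolding F_def by (intro Bochner_Integration.integrable_sum integrable_mult_right int)
  have IF: "(LINT y|M. F y) = (\<Sum>i\<in>I. v i * (\<Prod>l<n. 1 - indicator (B i) (x l) / 2) * (1 - prob (B i) / 2))"
    unfolding F_def
  proof (subst Bochner_Integration.integral_sum)
    show "integrable M (\<lambda>y. v i * (\<Prod>l<n. 1 - indicator (B i) (x l) / 2) * (1 - indicator (B i) y / 2))" if "i \<in> I" for i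
      using int[OF that] by simp
    have "(LINT y|M. 1 - indicator (B i) y / 2 :: real) = 1 - prob (B i) / 2" if "i \<in> I" for i
      using B[OF that]
      by (subst Bochner_Integration.integral_diff) (auto simp: prob_space less_top[symmetric])
    then show "(\<Sum>i\<in>I. (LINT y|M. v i * (\<Prod>l<n. 1 - indicator (B i) (x l) / 2) * (1 - indicator (B i) y / 2)))
      = (\<Sum>i\<in>I. v i * (\<Prod>l<n. 1 - indicator (B i) (x l) / 2) * (1 - prob (B i) / 2))"
      by (intro sum.cong) auto
  qed
  from exists_le_integral[OF F] obtain y where y: "y \<in> space M" "F y \<le> (LINT y|M. F y)" by blast
  define z where "z = x(n := y)"
  have "(\<Sum>i\<in>I. v i * (\<Prod>l<Suc n. 1 - indicator (B i) (z l) / 2)) = F y"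
    unfolding F_def by (intro sum.cong) (auto simp: z_def intro!: prod.cong)
  also have "\<dots> \<le> (\<Sum>i\<in>I. w i * (\<Prod>l<n. 1 - indicator (B i) (x l) / 2))"
    using y(2) by (simp add: IF w_def mult_ac)
  also note le
  also have "(\<Sum>i\<in>I. w i * (1 - prob (B i) / 2) ^ n) = (\<Sum>i\<in>I. v i * (1 - prob (B i) / 2) ^ Suc n)"
    by (simp add: w_def mult_ac)
  finally have "(\<Sum>i\<in>I. v i * (\<Prod>l<Suc n. 1 - indicator (B i) (z l) / 2)) \<le> \<dots>" .
  moreover have "\<forall>l<Suc n. z l \<in> space M"
    using x y by (auto simp: z_def less_Suc_eq)
  ultimately show ?case by blast
qed

text \<open>
  A Chernoff bound and a union bound in one: a set with fewer than \<open>q i * n / 4\<close> hits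
  would alone contribute more than \<open>1\<close> to the potential with weights \<open>exp (q i * n / 4)\<close>, whereas
  the potential is bounded by the sum in the last hypothesis.
\<close>

lemma (in prob_space) exists_hitting_points:
  fixes q :: "'i \<Rightarrow> real" and n :: nat
  assumes I: "finite I" and B: "\<And>i. i \<in> I \<Longrightarrow> B i \<in> sets M"
    and q: "\<And>i. i \<in> I \<Longrightarrow> q i \<le> prob (B i)"
    and small: "(\<Sum>i\<in>I. exp (- q i * n / 4)) < 1"
  shows "\<exists>x. (\<forall>l<n. x l \<in> space M) \<and>
    (\<forall>i\<in>I. q i * n / 4 \<le> card {l. l < n \<and> x l \<in> B i})"
proof -
  obtain x where x: "\<forall>l<n. x l \<in> space M"
    and le: "(\<Sum>i\<in>I. exp (q i * n / 4) * (\<Prod>l<n. 1 - indicator (B i) (x l) / 2)) \<le>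
      (\<Sum>i\<in>I. exp (q i * n / 4) * (1 - prob (B i) / 2) ^ n)"
    using exists_points_small_potential[of I B "\<lambda>i. exp (q i * n / 4)" n] I B by auto
  have "(\<Sum>i\<in>I. exp (q i * n / 4) * (1 - prob (B i) / 2) ^ n) \<le> (\<Sum>i\<in>I. exp (- q i * n / 4))"
  proof (rule sum_mono)
    fix i assume i: "i \<in> I"
    have "1 - prob (B i) / 2 \<le> exp (- q i / 2)"
      using exp_ge_add_one_self[of "- q i / 2"] q[OF i] by simp
    then have "(1 - prob (B i) / 2) ^ n \<le> exp (- q i / 2) ^ n"
      by (rule power_mono) (use prob_le_1[of "B i"] in linarith)
    also have "\<dots> = exp (- q i * n / 2)" by (simp flip: exp_of_nat_mult add: mult_ac)
    finally have "exp (q i * n / 4) * (1 - prob (B i) / 2) ^ n \<le> exp (q i * n / 4) * exp (- q i * n / 2)"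
      by simp
    also have "\<dots> = exp (- q i * n / 4)" by (simp flip: exp_add)
    finally show "exp (q i * n / 4) * (1 - prob (B i) / 2) ^ n \<le> exp (- q i * n / 4)" .
  qed
  with le small have lt: "(\<Sum>i\<in>I. exp (q i * n / 4) * (\<Prod>l<n. 1 - indicator (B i) (x l) / 2)) < 1"
    by linarith
  have "q i * n / 4 \<le> card {l. l < n \<and> x l \<in> B i}" if i: "i \<in> I" for i
  proof -
    let ?Z = "{l. l < n \<and> x l \<in> B i}"
    have "(\<Prod>l<n. 1 - indicator (B i) (x l) / 2 :: real) = (\<Prod>l<n. if x l \<in> B i then 1/2 else 1)"
      by (intro prod.cong) (auto simp: indicator_def)
    also have "\<dots> = (\<Prod>l\<in>{l\<in>{..<n}. x l \<in> B i}. 1/2)"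
      by (subst prod.inter_filter[symmetric]) auto
    also have "{l\<in>{..<n}. x l \<in> B i} = ?Z" by auto
    finally have eq: "(\<Prod>l<n. 1 - indicator (B i) (x l) / 2 :: real) = (1/2) ^ card ?Z" by simp
    \<comment> \<open>the potential only has the base \<open>1/2\<close>, which is larger than \<open>exp (-1)\<close>\<close>
    have e1: "exp (-1) \<le> (1/2::real)"
      using exp_ge_add_one_self[of "1::real"] by (simp add: exp_minus field_simps)
    have "exp (q i * n / 4 - card ?Z) = exp (q i * n / 4) * exp (-1) ^ card ?Z"
      by (simp flip: exp_of_nat_mult exp_add)
    also have "\<dots> \<le> exp (q i * n / 4) * (1/2) ^ card ?Z"
      by (intro mult_left_mono power_mono e1) auto
    also have "\<dots> = exp (q i * n / 4) * (\<Prod>l<n. 1 - indicator (B i) (x l) / 2)"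
      by (simp add: eq)
    also have "\<dots> \<le> (\<Sum>i\<in>I. exp (q i * n / 4) * (\<Prod>l<n. 1 - indicator (B i) (x l) / 2))"
      using I i by (intro member_le_sum) (auto intro!: mult_nonneg_nonneg prod_nonneg simp: indicator_def)
    also have "\<dots> < 1" by (rule lt)
    finally show ?thesis by simp
  qed
  with x show ?thesis by blast
qed

section \<open>Averages of dictionary elements\<close>

text \<open>
  Hoeffding's lemma for a finitely supported distribution \<open>w\<close>. Convexity replaces each
  \<open>f a\<close> by a two-point distribution on \<open>-1\<close> and \<open>1\<close> with the same mean, for which the bound
  is \<open>Hoeffdings_lemma_aux\<close>.
\<close>

lemma sum_exp_centered_le:
  fixes w f :: "'i \<Rightarrow> real"
  assumes D: "finite D" and w: "\<And>a. a \<in> D \<Longrightarrow> 0 \<le> w a" and w1: "sum w D = 1"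
    and f: "\<And>a. a \<in> D \<Longrightarrow> \<bar>f a\<bar> \<le> 1" and s: "0 \<le> s"
  shows "(\<Sum>a\<in>D. w a * exp (s * (f a - (\<Sum>b\<in>D. w b * f b)))) \<le> exp (s\<^sup>2 / 2)"
proof -
  define q where "q = (\<Sum>b\<in>D. w b * f b)"
  \<comment> \<open>weight of the point \<open>1\<close> in the two-point distribution with mean \<open>q\<close>\<close>
  define p where "p = (1 + q) / 2"
  have p_sum: "(\<Sum>a\<in>D. w a * ((1 + f a) / 2)) = p"
    by (simp add: p_def q_def algebra_simps sum.distrib w1 flip: sum_divide_distrib)
  have p0: "0 \<le> p"
    unfolding p_sum[symmetric] using w f by (intro sum_nonneg mult_nonneg_nonneg) (auto simp: abs_le_iff, smt (verit) f)
  have chord: "exp (s * f a) \<le> exp (-s) + (1 + f a) / 2 * (exp s - exp (-s))" if "a \<in> D" for a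
  proof -
    define y where "y = (1 + f a) / 2"
    have y: "0 \<le> y" "y \<le> 1" using f[OF that] by (auto simp: y_def)
    have "exp (s * ((1 - y) *\<^sub>R (-1) + y *\<^sub>R 1)) \<le> (1 - y) * exp (s * (-1)) + y * exp (s * 1)"
      using y s by (intro convex_onD[OF convex_on_exp]) auto
    also have "(1 - y) *\<^sub>R (-1) + y *\<^sub>R 1 = f a" by (simp add: y_def field_simps)
    finally show ?thesis by (simp add: y_def[symmetric] algebra_simps)
  qed
  have "(\<Sum>a\<in>D. w a * exp (s * f a)) \<le> (\<Sum>a\<in>D. w a * (exp (-s) + (1 + f a) / 2 * (exp s - exp (-s))))"
    using w by (intro sum_mono mult_left_mono chord) auto
  also have "\<dots> = (\<Sum>a\<in>D. w a * exp (-s)) + (\<Sum>a\<in>D. w a * ((1 + f a) / 2) * (exp s - exp (-s)))"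
    by (simp add: algebra_simps flip: sum.distrib)
  also have "\<dots> = exp (-s) + p * (exp s - exp (-s))"
    unfolding sum_distrib_right[symmetric] p_sum w1 by simp
  also have "\<dots> = exp (-s) * (1 + p * (exp (2 * s) - 1))"
    by (simp add: algebra_simps flip: exp_add)
  also have "1 + p * (exp (2 * s) - 1) = exp (ln (1 + p * (exp (2 * s) - 1)))"
  proof -
    have "0 \<le> p * (exp (2 * s) - 1)" using p0 s by (intro mult_nonneg_nonneg) auto
    then show ?thesis by (subst exp_ln) auto
  qed
  also have "\<dots> \<le> exp (s\<^sup>2 / 2 + 2 * s * p)"
    using Hoeffdings_lemma_aux[of "2 * s" p] s p0 by (simp add: power2_eq_square)
  also have "exp (-s) * exp (s\<^sup>2 / 2 + 2 * s * p) = exp (s\<^sup>2 / 2) * exp (s * q)"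
    by (simp add: p_def algebra_simps add_divide_distrib flip: exp_add)
  finally have le: "(\<Sum>a\<in>D. w a * exp (s * f a)) \<le> exp (s\<^sup>2 / 2) * exp (s * q)" by simp
  have "(\<Sum>a\<in>D. w a * exp (s * (f a - q))) = (\<Sum>a\<in>D. w a * exp (s * f a)) * exp (- s * q)"
    by (simp add: sum_distrib_right mult.assoc right_diff_distrib flip: exp_add)
  also have "\<dots> \<le> exp (s\<^sup>2 / 2) * exp (s * q) * exp (- s * q)"
    using le by (intro mult_right_mono) auto
  also have "\<dots> = exp (s\<^sup>2 / 2)" by (simp add: mult.assoc flip: exp_add)
  finally show ?thesis by (simp add: q_def)
qed

text \<open>
  Hoeffding's inequality for \<open>m\<close> independent draws from \<open>w\<close>, with the product measure written
  as a weighted sum over tuples. In this form the moment generating function factorises by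
  \<open>prod_sum_PiE\<close>, and integrals over the cube may later be exchanged with the finite sum.
\<close>

lemma weighted_tuples_tail_one_sided:
  fixes w f :: "'i \<Rightarrow> real" and m :: nat and s :: real
  assumes D: "finite D" and w: "\<And>a. a \<in> D \<Longrightarrow> 0 \<le> w a" and w1: "sum w D = 1"
    and f: "\<And>a. a \<in> D \<Longrightarrow> \<bar>f a\<bar> \<le> 1" and s: "0 \<le> s"
  defines "q \<equiv> (\<Sum>b\<in>D. w b * f b)"
  shows "(\<Sum>\<kappa>\<in>PiE {..<m} (\<lambda>_. D). (\<Prod>l<m. w (\<kappa> l)) * of_bool (m * s \<le> (\<Sum>l<m. f (\<kappa> l) - q))) \<le> exp (- real m * s\<^sup>2 / 2)"
proof -
  have "(\<Sum>\<kappa>\<in>PiE {..<m} (\<lambda>_. D). (\<Prod>l<m. w (\<kappa> l)) * of_bool (m * s \<le> (\<Sum>l<m. f (\<kappa> l) - q)))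
    \<le> (\<Sum>\<kappa>\<in>PiE {..<m} (\<lambda>_. D). (\<Prod>l<m. w (\<kappa> l)) * exp (s * ((\<Sum>l<m. f (\<kappa> l) - q) - m * s)))"
  proof (intro sum_mono mult_left_mono)
    fix \<kappa> assume k: "\<kappa> \<in> PiE {..<m} (\<lambda>_. D)"
    then show "0 \<le> (\<Prod>l<m. w (\<kappa> l))" by (intro prod_nonneg w) auto
    show "of_bool (m * s \<le> (\<Sum>l<m. f (\<kappa> l) - q)) \<le> exp (s * ((\<Sum>l<m. f (\<kappa> l) - q) - m * s))"
      using s by (cases "m * s \<le> (\<Sum>l<m. f (\<kappa> l) - q)") auto
  qed
  also have "\<dots> = (\<Sum>\<kappa>\<in>PiE {..<m} (\<lambda>_. D). exp (- real m * s\<^sup>2) * (\<Prod>l<m. w (\<kappa> l) * exp (s * (f (\<kappa> l) - q))))"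
  proof (intro sum.cong refl)
    fix \<kappa>
    have "(\<Prod>l<m. exp (s * (f (\<kappa> l) - q))) = exp (s * (\<Sum>l<m. f (\<kappa> l) - q))"
      by (simp only: exp_sum[symmetric] sum_distrib_left finite_lessThan)
    moreover have "exp (s * ((\<Sum>l<m. f (\<kappa> l) - q) - m * s)) = exp (- real m * s\<^sup>2) * exp (s * (\<Sum>l<m. f (\<kappa> l) - q))"
      unfolding exp_add[symmetric] by (simp add: power2_eq_square right_diff_distrib)
    ultimately show "(\<Prod>l<m. w (\<kappa> l)) * exp (s * ((\<Sum>l<m. f (\<kappa> l) - q) - m * s)) =
        exp (- real m * s\<^sup>2) * (\<Prod>l<m. w (\<kappa> l) * exp (s * (f (\<kappa> l) - q)))"
      by (simp only: prod.distrib mult_ac)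
  qed
  also have "\<dots> = exp (- real m * s\<^sup>2) * (\<Prod>l<m. \<Sum>a\<in>D. w a * exp (s * (f a - q)))"
    using D by (subst prod_sum_PiE) (auto simp: sum_distrib_left)
  also have "\<dots> \<le> exp (- real m * s\<^sup>2) * (\<Prod>l<m. exp (s\<^sup>2 / 2))"
  proof (intro mult_left_mono prod_mono conjI)
    show "0 \<le> (\<Sum>a\<in>D. w a * exp (s * (f a - q)))" using w by (intro sum_nonneg) auto
    show "(\<Sum>a\<in>D. w a * exp (s * (f a - q))) \<le> exp (s\<^sup>2 / 2)"
      using sum_exp_centered_le[OF D w w1 f s] by (simp add: q_def)
  qed auto
  also have "\<dots> = exp (- real m * s\<^sup>2 / 2)"
    by (simp flip: exp_of_nat_mult exp_add)
  finally show ?thesis .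
qed

lemma weighted_tuples_tail:
  fixes w f :: "'i \<Rightarrow> real" and m :: nat and s :: real
  assumes D: "finite D" and w: "\<And>a. a \<in> D \<Longrightarrow> 0 \<le> w a" and w1: "sum w D = 1"
    and f: "\<And>a. a \<in> D \<Longrightarrow> \<bar>f a\<bar> \<le> 1" and s: "0 \<le> s" and m: "0 < m"
  shows "(\<Sum>\<kappa>\<in>PiE {..<m} (\<lambda>_. D). (\<Prod>l<m. w (\<kappa> l)) *
      of_bool (s \<le> \<bar>(\<Sum>l<m. f (\<kappa> l)) / m - (\<Sum>b\<in>D. w b * f b)\<bar>)) \<le> 2 * exp (- real m * s\<^sup>2 / 2)"
proof -
  define q where "q = (\<Sum>b\<in>D. w b * f b)"
  have f': "\<bar>- f a\<bar> \<le> 1" if "a \<in> D" for a using f[OF that] by simp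
  have q': "(\<Sum>b\<in>D. w b * - f b) = - q" by (simp add: q_def sum_negf)
  have "(\<Sum>\<kappa>\<in>PiE {..<m} (\<lambda>_. D). (\<Prod>l<m. w (\<kappa> l)) * of_bool (s \<le> \<bar>(\<Sum>l<m. f (\<kappa> l)) / m - q\<bar>))
    \<le> (\<Sum>\<kappa>\<in>PiE {..<m} (\<lambda>_. D). (\<Prod>l<m. w (\<kappa> l)) * of_bool (m * s \<le> (\<Sum>l<m. f (\<kappa> l) - q))
        + (\<Prod>l<m. w (\<kappa> l)) * of_bool (m * s \<le> (\<Sum>l<m. - f (\<kappa> l) - - q)))"
    unfolding distrib_left[symmetric]
  proof (intro sum_mono mult_left_mono)
    fix \<kappa> assume k: "\<kappa> \<in> PiE {..<m} (\<lambda>_. D)"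
    then show "0 \<le> (\<Prod>l<m. w (\<kappa> l))" by (intro prod_nonneg w) auto
    have "s \<le> (\<Sum>l<m. f (\<kappa> l)) / m - q \<or> s \<le> q - (\<Sum>l<m. f (\<kappa> l)) / m"
      if "s \<le> \<bar>(\<Sum>l<m. f (\<kappa> l)) / m - q\<bar>"
      using that by linarith
    then show "of_bool (s \<le> \<bar>(\<Sum>l<m. f (\<kappa> l)) / m - q\<bar>) \<le>
      (of_bool (m * s \<le> (\<Sum>l<m. f (\<kappa> l) - q)) + of_bool (m * s \<le> (\<Sum>l<m. - f (\<kappa> l) - - q)) :: real)"
      using m by (auto simp: sum_subtractf sum_negf field_simps of_bool_def)
  qed
  also have "\<dots> \<le> exp (- real m * s\<^sup>2 / 2) + exp (- real m * s\<^sup>2 / 2)"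
    unfolding sum.distrib
    using weighted_tuples_tail_one_sided[of D w f s m] weighted_tuples_tail_one_sided[of D w "\<lambda>a. - f a" s m]
      D w w1 f s by (intro add_mono) (auto simp: q_def sum_negf)
  finally show ?thesis by (simp add: q_def)
qed

lemma exists_le_weighted_sum:
  fixes W F :: "'i \<Rightarrow> real"
  assumes "finite K" and W: "\<And>k. k \<in> K \<Longrightarrow> 0 \<le> W k" and W1: "sum W K = 1"
    and le: "(\<Sum>k\<in>K. W k * F k) \<le> c"
  shows "\<exists>k\<in>K. F k \<le> c"
proof (rule ccontr)
  assume "\<not> ?thesis"
  then have F: "\<And>k. k \<in> K \<Longrightarrow> c < F k" by force
  obtain k where k: "k \<in> K" "W k \<noteq> 0"
    using W1 by (metis sum.neutral zero_neq_one)
  have "(\<Sum>k\<in>K. W k * c) < (\<Sum>k\<in>K. W k * F k)"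
    using assms(1) W F k by (intro sum_strict_mono_ex1) (auto intro!: mult_left_mono mult_strict_left_mono bexI[of _ k] simp: less_le)
  then show False using le W1 by (simp flip: sum_distrib_right)
qed

text \<open>
  Maurey's empirical method. For each fixed point the average of a random tuple misses the convex combination by \<open>s\<close>
  with exponentially small probability, so the expected bad measure and the expected bad fraction of
  the sample points are small, and a single tuple achieves both. The sample points enter as an
  additional discrete measure because the tuple may depend on them.
\<close>

lemma (in prob_space) exists_tuple_average:
  fixes \<psi> :: "'i \<Rightarrow> 'a \<Rightarrow> real" and w :: "'i \<Rightarrow> real" and m n :: nat and s :: real
  assumes D: "finite D" and w: "\<And>a. a \<in> D \<Longrightarrow> 0 \<le> w a" and w1: "sum w D = 1"
    and \<psi>[measurable]: "\<And>a. a \<in> D \<Longrightarrow> \<psi> a \<in> borel_measurable M"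
    and bd: "\<And>a x. a \<in> D \<Longrightarrow> x \<in> space M \<Longrightarrow> \<bar>\<psi> a x\<bar> \<le> 1"
    and s: "0 \<le> s" and m: "0 < m" and n: "0 < n" and x: "\<And>l. l < n \<Longrightarrow> x l \<in> space M"
  shows "\<exists>\<kappa>\<in>PiE {..<m} (\<lambda>_. D).
    prob {y\<in>space M. s \<le> \<bar>(\<Sum>l<m. \<psi> (\<kappa> l) y) / m - (\<Sum>b\<in>D. w b * \<psi> b y)\<bar>} +
    card {i. i < n \<and> s \<le> \<bar>(\<Sum>l<m. \<psi> (\<kappa> l) (x i)) / m - (\<Sum>b\<in>D. w b * \<psi> b (x i))\<bar>} / n
      \<le> 4 * exp (- real m * s\<^sup>2 / 2)"
proof -
  define K where "K = PiE {..<m} (\<lambda>_. D)"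
  define W where "W \<kappa> = (\<Prod>l<m. w (\<kappa> l))" for \<kappa>
  define bad where "bad \<kappa> y \<longleftrightarrow> s \<le> \<bar>(\<Sum>l<m. \<psi> (\<kappa> l) y) / m - (\<Sum>b\<in>D. w b * \<psi> b y)\<bar>" for \<kappa> y
  have K: "finite K" unfolding K_def using D by (intro finite_PiE) auto
  have W: "0 \<le> W \<kappa>" if "\<kappa> \<in> K" for \<kappa>
    using that unfolding W_def K_def by (intro prod_nonneg w) auto
  have W1: "sum W K = 1"
    unfolding W_def K_def using prod_sum_PiE[of "{..<m}" "\<lambda>_. D" "\<lambda>_. w"] D by (simp add: w1)
  have tail: "(\<Sum>\<kappa>\<in>K. W \<kappa> * of_bool (bad \<kappa> y)) \<le> 2 * exp (- real m * s\<^sup>2 / 2)" if "y \<in> space M" for y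
    unfolding W_def K_def bad_def
    using weighted_tuples_tail[OF D w w1 bd[OF _ that] s m] by simp
  have meas: "{y\<in>space M. bad \<kappa> y} \<in> sets M" if "\<kappa> \<in> K" for \<kappa>
  proof -
    have [measurable]: "\<psi> (\<kappa> l) \<in> borel_measurable M" if "l < m" for l
      by (intro \<psi>) (use \<open>\<kappa> \<in> K\<close> that in \<open>auto simp: K_def\<close>)
    have "(\<lambda>y. \<Sum>l<m. \<psi> (\<kappa> l) y) \<in> borel_measurable M" "(\<lambda>y. \<Sum>b\<in>D. w b * \<psi> b y) \<in> borel_measurable M"
      by (intro borel_measurable_sum; simp; measurable)+
    note [measurable] = this
    show ?thesis unfolding bad_def by measurable
  qed
  have bad_int: "integrable M (\<lambda>y. of_bool (bad \<kappa> y) :: real)" 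
    "prob {y\<in>space M. bad \<kappa> y} = (LINT y|M. of_bool (bad \<kappa> y))" if "\<kappa> \<in> K" for \<kappa>
  proof -
    have "integrable M (indicator {y\<in>space M. bad \<kappa> y} :: _ \<Rightarrow> real)"
      using meas[OF that] by (auto simp: less_top[symmetric])
    then show "integrable M (\<lambda>y. of_bool (bad \<kappa> y) :: real)"
      by (subst (asm) Bochner_Integration.integrable_cong[OF refl, of _ _ "\<lambda>y. of_bool (bad \<kappa> y)"]) auto
    have "prob {y\<in>space M. bad \<kappa> y} = (LINT y|M. indicator {y\<in>space M. bad \<kappa> y} y)"
      using meas[OF that] by simp
    also have "\<dots> = (LINT y|M. of_bool (bad \<kappa> y))"
      by (intro Bochner_Integration.integral_cong) auto
    finally show "prob {y\<in>space M. bad \<kappa> y} = (LINT y|M. of_bool (bad \<kappa> y))" .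
  qed
  have "(\<Sum>\<kappa>\<in>K. W \<kappa> * prob {y\<in>space M. bad \<kappa> y}) = (LINT y|M. (\<Sum>\<kappa>\<in>K. W \<kappa> * of_bool (bad \<kappa> y)))"
    by (subst Bochner_Integration.integral_sum) (auto simp: bad_int intro!: integrable_mult_right sum.cong)
  also have "\<dots> \<le> (LINT y|M. 2 * exp (- real m * s\<^sup>2 / 2))"
    using tail by (intro integral_mono) (auto intro!: Bochner_Integration.integrable_sum integrable_mult_right bad_int)
  finally have 1: "(\<Sum>\<kappa>\<in>K. W \<kappa> * prob {y\<in>space M. bad \<kappa> y}) \<le> 2 * exp (- real m * s\<^sup>2 / 2)"
    by (simp add: prob_space)
  have card: "real (card {i. i < n \<and> bad \<kappa> (x i)}) = (\<Sum>i<n. of_bool (bad \<kappa> (x i)))" for \<kappa>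
    by (simp add: of_bool_def sum.If_cases Int_def)
  have "(\<Sum>\<kappa>\<in>K. W \<kappa> * (card {i. i < n \<and> bad \<kappa> (x i)} / n)) =
      (\<Sum>\<kappa>\<in>K. \<Sum>i<n. W \<kappa> * of_bool (bad \<kappa> (x i))) / n"
    unfolding card sum_divide_distrib sum_distrib_left by (simp only: times_divide_eq_right)
  also have "(\<Sum>\<kappa>\<in>K. \<Sum>i<n. W \<kappa> * of_bool (bad \<kappa> (x i))) = (\<Sum>i<n. \<Sum>\<kappa>\<in>K. W \<kappa> * of_bool (bad \<kappa> (x i)))"
    by (rule sum.swap)
  also have "\<dots> / n \<le> (\<Sum>i<n. 2 * exp (- real m * s\<^sup>2 / 2)) / n"
    by (intro divide_right_mono sum_mono tail x) auto
  finally have 2: "(\<Sum>\<kappa>\<in>K. W \<kappa> * (card {i. i < n \<and> bad \<kappa> (x i)} / n)) \<le> 2 * exp (- real m * s\<^sup>2 / 2)"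
    using n by simp
  have "(\<Sum>\<kappa>\<in>K. W \<kappa> * (prob {y\<in>space M. bad \<kappa> y} + card {i. i < n \<and> bad \<kappa> (x i)} / n)) \<le> 4 * exp (- real m * s\<^sup>2 / 2)"
    using 1 2 by (simp add: distrib_left sum.distrib)
  from exists_le_weighted_sum[OF K W W1 this] show ?thesis
    unfolding K_def bad_def by blast
qed

section \<open>Sample points that detect sparse combinations\<close>

text \<open>
  Only the largest dyadic level below \<open>\<bar>r\<bar>\<close> matters: if \<open>j\<close> is least with
  \<open>2\<^bsup>-j\<^esup> < \<bar>r\<bar>\<close>, then \<open>r\<^sup>2 \<le> 4 \<cdot> 4\<^bsup>-j\<^esup>\<close>.
\<close>

lemma square_le_dyadic_sum:
  fixes r :: real
  assumes "\<bar>r\<bar> \<le> 1"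
  shows "r\<^sup>2 \<le> (1/4) ^ J + (\<Sum>j=1..J. 4 * (1/4) ^ j * of_bool ((1/2) ^ j < \<bar>r\<bar>))"
proof (cases "\<bar>r\<bar> \<le> (1/2) ^ J")
  case True
  have "r\<^sup>2 \<le> ((1/2) ^ J)\<^sup>2" using True abs_le_square_iff[of r "(1/2) ^ J"] by simp
  also have "\<dots> = (1/4) ^ J" by (simp add: power2_eq_square flip: power_mult_distrib)
  also have "\<dots> \<le> (1/4) ^ J + (\<Sum>j=1..J. 4 * (1/4) ^ j * of_bool ((1/2) ^ j < \<bar>r\<bar>))"
    by (simp add: sum_nonneg)
  finally show ?thesis .
next
  case False
  define i where "i = (LEAST j. (1/2) ^ j < \<bar>r\<bar>)"
  have i: "(1/2) ^ i < \<bar>r\<bar>" unfolding i_def by (rule LeastI[of _ J]) (use False in simp)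
  have iJ: "i \<le> J" unfolding i_def by (rule Least_le) (use False in simp)
  have i0: "i \<noteq> 0" using i assms by (cases "i = 0") auto
  then obtain k where k: "i = Suc k" using not0_implies_Suc by blast
  have "\<not> (1/2) ^ k < \<bar>r\<bar>" using not_less_Least[of k "\<lambda>j. (1/2) ^ j < \<bar>r\<bar>"] k by (simp add: i_def)
  then have "r\<^sup>2 \<le> ((1/2) ^ k)\<^sup>2" using abs_le_square_iff[of r "(1/2) ^ k"] by simp
  also have "\<dots> = (1/4) ^ k" by (simp add: power2_eq_square flip: power_mult_distrib)
  also have "\<dots> = 4 * (1/4) ^ i * of_bool ((1/2) ^ i < \<bar>r\<bar>)" using i k by simp
  also have "\<dots> \<le> (\<Sum>j=1..J. 4 * (1/4) ^ j * of_bool ((1/2) ^ j < \<bar>r\<bar>))"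
    using i0 iJ by (intro member_le_sum) auto
  also have "\<dots> \<le> (1/4) ^ J + (\<Sum>j=1..J. 4 * (1/4) ^ j * of_bool ((1/2) ^ j < \<bar>r\<bar>))" by simp
  finally show ?thesis .
qed

text \<open>
  Pigeonhole over the \<open>J\<close> levels of the integrated dyadic bound.
\<close>

lemma (in prob_space) exists_large_level:
  fixes q :: "'a \<Rightarrow> real"
  assumes [measurable]: "q \<in> borel_measurable M" and bd: "\<And>x. x \<in> space M \<Longrightarrow> \<bar>q x\<bar> \<le> 1"
    and J: "1 \<le> J" and big: "2 * (1/4) ^ J \<le> (LINT x|M. (q x)\<^sup>2)"
  shows "\<exists>j\<in>{1..J}. 4 ^ j * (1/4) ^ J / (4 * J) \<le> prob {x\<in>space M. (1/2) ^ j < \<bar>q x\<bar>}"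
proof (rule ccontr)
  assume "\<not> ?thesis"
  then have small: "\<And>j. j \<in> {1..J} \<Longrightarrow> prob {x\<in>space M. (1/2) ^ j < \<bar>q x\<bar>} < 4 ^ j * (1/4) ^ J / (4 * J)"
    by force
  have ind: "integrable M (\<lambda>x. of_bool ((1/2) ^ j < \<bar>q x\<bar>) :: real)"
    "(LINT x|M. of_bool ((1/2) ^ j < \<bar>q x\<bar>)) = prob {x\<in>space M. (1/2) ^ j < \<bar>q x\<bar>}" for j :: nat
  proof -
    show "integrable M (\<lambda>x. of_bool ((1/2) ^ j < \<bar>q x\<bar>) :: real)"
      by (rule integrable_const_bound[where B=1]) auto
    have "(LINT x|M. of_bool ((1/2) ^ j < \<bar>q x\<bar>)) = (LINT x|M. indicator {x\<in>space M. (1/2) ^ j < \<bar>q x\<bar>} x :: real)"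
      by (intro Bochner_Integration.integral_cong) auto
    then show "(LINT x|M. of_bool ((1/2) ^ j < \<bar>q x\<bar>)) = prob {x\<in>space M. (1/2) ^ j < \<bar>q x\<bar>}" by simp
  qed
  have "(LINT x|M. (q x)\<^sup>2) \<le> (LINT x|M. (1/4) ^ J + (\<Sum>j=1..J. 4 * (1/4) ^ j * of_bool ((1/2) ^ j < \<bar>q x\<bar>)))"
  proof (rule integral_mono)
    show "integrable M (\<lambda>x. (q x)\<^sup>2)"
      by (rule integrable_const_bound[where B=1]) (use bd in \<open>auto simp: abs_square_le_1\<close>)
    show "integrable M (\<lambda>x. (1/4) ^ J + (\<Sum>j=1..J. 4 * (1/4) ^ j * of_bool ((1/2) ^ j < \<bar>q x\<bar>)) :: real)"
      by (intro Bochner_Integration.integrable_add Bochner_Integration.integrable_sum integrable_mult_right ind) auto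
    show "(q x)\<^sup>2 \<le> (1/4) ^ J + (\<Sum>j=1..J. 4 * (1/4) ^ j * of_bool ((1/2) ^ j < \<bar>q x\<bar>))" if "x \<in> space M" for x
      by (rule square_le_dyadic_sum[OF bd[OF that]])
  qed
  also have "\<dots> = (1/4) ^ J + (\<Sum>j=1..J. 4 * (1/4) ^ j * prob {x\<in>space M. (1/2) ^ j < \<bar>q x\<bar>})"
  proof (subst Bochner_Integration.integral_add)
    show "integrable M (\<lambda>x. (\<Sum>j=1..J. 4 * (1/4) ^ j * of_bool ((1/2) ^ j < \<bar>q x\<bar>)) :: real)"
      by (intro Bochner_Integration.integrable_sum integrable_mult_right ind)
    have "(LINT x|M. (\<Sum>j=1..J. (4::real) * (1/4) ^ j * of_bool ((1/2) ^ j < \<bar>q x\<bar>))) =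
        (\<Sum>j=1..J. LINT x|M. (4::real) * (1/4) ^ j * of_bool ((1/2) ^ j < \<bar>q x\<bar>))"
      by (intro Bochner_Integration.integral_sum integrable_mult_right ind)
    then show "(LINT x|M. (1/4) ^ J) + (LINT x|M. (\<Sum>j=1..J. 4 * (1/4) ^ j * of_bool ((1/2) ^ j < \<bar>q x\<bar>))) =
        (1/4) ^ J + (\<Sum>j=1..J. 4 * (1/4) ^ j * prob {x\<in>space M. (1/2) ^ j < \<bar>q x\<bar>})"
      by (simp only: integral_mult_right_zero ind lebesgue_integral_const prob_space scaleR_one)
  qed simp
  also have "(\<Sum>j=1..J. 4 * (1/4) ^ j * prob {x\<in>space M. (1/2) ^ j < \<bar>q x\<bar>}) <
      (\<Sum>j=1..J. 4 * (1/4) ^ j * (4 ^ j * (1/4) ^ J / (4 * J)))"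
    using J small by (intro sum_strict_mono mult_strict_left_mono) auto
  also have "\<dots> = (\<Sum>j=1..J. (1/4) ^ J / J)"
    by (intro sum.cong) (auto simp: field_simps)
  also have "\<dots> = (1/4) ^ J" using J by simp
  finally show False using big by simp
qed

text \<open>
  The failure probability of the averages with \<open>288 \<cdot> 4\<^sup>j \<cdot> J\<close> terms, compared with a fixed
  fraction of the least measure \<open>4\<^bsup>1-J\<^esup> / (4 J)\<close> that a large level set can have.
\<close>

lemma maurey_tail_le_level_mass:
  assumes "1 \<le> J"
  shows "4 * exp (- (9 * real J)) \<le> (1/4) ^ J / (16 * J)"
proof -
  have "2 ^ 9 \<le> exp (1::real) ^ 9"
    by (rule power_mono) (use exp_ge_add_one_self[of "1::real"] in auto)
  then have "(2 ^ 9) ^ J \<le> exp (9::real) ^ J"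
    by (intro power_mono) (auto simp flip: exp_of_nat_mult)
  then have e: "512 ^ J \<le> exp (9 * real J)"
    by (simp flip: exp_of_nat_mult add: mult.commute)
  have "64 * real J * 4 ^ J \<le> 64 ^ J * 2 ^ J * 4 ^ J"
    using assms power_increasing[of 1 J "64::real"] of_nat_less_two_power[of J, where 'a=real]
    by (intro mult_mono) auto
  also have "\<dots> = 512 ^ J" by (simp flip: power_mult_distrib)
  also note e
  finally show ?thesis
    using assms by (simp add: exp_minus field_simps power_divide)
qed

text \<open>
  The points are chosen to hit, for each level \<open>j\<close>, the set \<open>\<bar>g\<bar> > (3/4) \<cdot> 2\<^bsup>-j\<^esup>\<close> for every
  average \<open>g\<close> of \<open>m j\<close> dictionary elements for which this set has measure at least \<open>p j / 2\<close>.
  Given \<open>q\<close>, its large level and a close average \<open>g\<close>, the points at which \<open>g\<close> is large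
  outnumber those at which \<open>g\<close> is far from \<open>q\<close>, so \<open>q\<close> is large at one of them.
\<close>

lemma (in prob_space) exists_detecting_points_convex:
  fixes \<psi> :: "'i \<Rightarrow> 'a \<Rightarrow> real" and n :: nat
  assumes D: "finite D" and D2: "2 \<le> card D"
    and [measurable]: "\<And>a. a \<in> D \<Longrightarrow> \<psi> a \<in> borel_measurable M"
    and bd: "\<And>a x. a \<in> D \<Longrightarrow> x \<in> space M \<Longrightarrow> \<bar>\<psi> a x\<bar> \<le> 1"
    and J: "1 \<le> J" and n: "18432 * real J ^ 2 * 4 ^ J * ln (card D) \<le> n"
  shows "\<exists>x. (\<forall>l<n. x l \<in> space M) \<and>
    (\<forall>w. (\<forall>a\<in>D. 0 \<le> w a) \<longrightarrow> sum w D = 1 \<longrightarrow>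
      2 * (1/4) ^ J \<le> (LINT y|M. (\<Sum>a\<in>D. w a * \<psi> a y)\<^sup>2) \<longrightarrow>
      (\<exists>l<n. (1/2) ^ J / 2 < \<bar>\<Sum>a\<in>D. w a * \<psi> a (x l)\<bar>))"
proof -
  define N where "N = card D"
  define m where "m j = 288 * 4 ^ j * J" for j :: nat
  define p :: "nat \<Rightarrow> real" where "p j = 4 ^ j * (1/4) ^ J / (4 * J)" for j
  define g where "g j \<kappa> y = (\<Sum>l<m j. \<psi> (\<kappa> l) y) / m j" for j \<kappa> y
  define B where "B = (\<lambda>(j, \<kappa>). {y\<in>space M. 3/4 * (1/2) ^ j < \<bar>g j \<kappa> y\<bar>})"
  define I where "I = (SIGMA j:{1..J}. {\<kappa>\<in>PiE {..<m j} (\<lambda>_. D). p j / 2 \<le> prob (B (j, \<kappa>))})"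
  have N2: "2 \<le> N" and lnN: "0 < ln (real N)" using D2 by (auto simp: N_def)
  have m0: "0 < m j" for j using J by (simp add: m_def)
  have p0: "0 < p j" for j using J by (simp add: p_def)
  have "0 < 18432 * real J ^ 2 * 4 ^ J * ln (real N)" using J lnN by simp
  with n have n0: "0 < n" unfolding N_def[symmetric] by (cases n) auto
  have fin: "finite {\<kappa>\<in>PiE {..<m j} (\<lambda>_. D). p j / 2 \<le> prob (B (j, \<kappa>))}"
    and cardle: "card {\<kappa>\<in>PiE {..<m j} (\<lambda>_. D). p j / 2 \<le> prob (B (j, \<kappa>))} \<le> N ^ m j" for j
  proof -
    have f: "finite (PiE {..<m j} (\<lambda>_. D))" using D by (intro finite_PiE) auto
    then show "finite {\<kappa>\<in>PiE {..<m j} (\<lambda>_. D). p j / 2 \<le> prob (B (j, \<kappa>))}" by simp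
    have "card {\<kappa>\<in>PiE {..<m j} (\<lambda>_. D). p j / 2 \<le> prob (B (j, \<kappa>))} \<le> card (PiE {..<m j} (\<lambda>_. D))"
      by (rule card_mono[OF f]) auto
    then show "card {\<kappa>\<in>PiE {..<m j} (\<lambda>_. D). p j / 2 \<le> prob (B (j, \<kappa>))} \<le> N ^ m j"
      by (simp add: card_PiE N_def)
  qed
  have I: "finite I" unfolding I_def using fin by (intro finite_SigmaI) auto
  have gm[measurable]: "g j \<kappa> \<in> borel_measurable M" if "\<kappa> \<in> PiE {..<m j} (\<lambda>_. D)" for j \<kappa>
  proof -
    have "\<psi> (\<kappa> l) \<in> borel_measurable M" if "l \<in> {..<m j}" for l
      using that \<open>\<kappa> \<in> PiE {..<m j} (\<lambda>_. D)\<close> by (intro assms(3)) auto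
    then show ?thesis unfolding g_def by (intro borel_measurable_divide borel_measurable_sum) auto
  qed
  have Bm: "B i \<in> sets M" if "i \<in> I" for i
  proof -
    obtain j \<kappa> where i: "i = (j, \<kappa>)" by (cases i)
    with that have [measurable]: "g j \<kappa> \<in> borel_measurable M" by (intro gm) (auto simp: I_def)
    show ?thesis unfolding B_def i by simp
  qed
  have "(\<Sum>i\<in>I. exp (- (p (fst i) / 2) * n / 4)) =
      (\<Sum>j=1..J. \<Sum>\<kappa>\<in>{\<kappa>\<in>PiE {..<m j} (\<lambda>_. D). p j / 2 \<le> prob (B (j, \<kappa>))}. exp (- (p j / 2) * n / 4))"
    unfolding I_def using fin by (subst sum.Sigma) (auto intro!: sum.cong)
  also have "\<dots> \<le> (\<Sum>j=1..J. (1/2) ^ j)"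
  proof (rule sum_mono)
    fix j assume j: "j \<in> {1..J}"
    \<comment> \<open>the constant in the hypothesis on \<open>n\<close> is \<open>2 \<cdot> 288 \<cdot> 32\<close>; the factor \<open>2\<close> leaves \<open>N ^ (- m j)\<close> after the union bound\<close>
    have "2 * m j * ln N = 4 ^ j * (1/4) ^ J / (32 * J) * (18432 * real J ^ 2 * 4 ^ J * ln N)"
      using J by (simp add: m_def power2_eq_square field_simps power_divide)
    also have "\<dots> \<le> 4 ^ j * (1/4) ^ J / (32 * J) * n"
      using n by (intro mult_left_mono) (auto simp: N_def)
    also have "\<dots> = p j / 2 * n / 4" by (simp add: p_def)
    finally have "exp (- (p j / 2) * n / 4) \<le> exp (- (2 * m j * ln N))" by simp
    also have "\<dots> = exp (- ln N) ^ (2 * m j)" by (simp flip: exp_of_nat_mult)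
    also have "\<dots> = (1 / N) ^ (2 * m j)" using N2 by (simp add: exp_minus inverse_eq_divide)
    finally have e: "exp (- (p j / 2) * n / 4) \<le> (1 / N) ^ (2 * m j)" .
    have "(\<Sum>\<kappa>\<in>{\<kappa>\<in>PiE {..<m j} (\<lambda>_. D). p j / 2 \<le> prob (B (j, \<kappa>))}. exp (- (p j / 2) * n / 4))
      = card {\<kappa>\<in>PiE {..<m j} (\<lambda>_. D). p j / 2 \<le> prob (B (j, \<kappa>))} * exp (- (p j / 2) * n / 4)" by simp
    also have "\<dots> \<le> real (N ^ m j) * (1 / N) ^ (2 * m j)"
      by (rule mult_mono[OF _ e]) (use cardle[of j] in \<open>auto simp del: of_nat_power\<close>)
    also have "\<dots> = (1 / N) ^ m j"
      using N2 by (simp add: power_divide mult_2 power_add)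
    also have "\<dots> \<le> (1 / 2) ^ m j" using N2 by (intro power_mono) (auto simp: field_simps)
    also have "\<dots> \<le> (1/2) ^ j"
    proof (rule power_decreasing)
      have "j \<le> J" using j by simp
      also have "J \<le> 288 * 4 ^ j * J" by simp
      finally show "j \<le> m j" by (simp add: m_def)
    qed auto
    finally show "(\<Sum>\<kappa>\<in>{\<kappa>\<in>PiE {..<m j} (\<lambda>_. D). p j / 2 \<le> prob (B (j, \<kappa>))}. exp (- (p j / 2) * n / 4)) \<le> (1/2) ^ j" .
  qed
  also have "\<dots> = 1 - (1/2) ^ J" by (induction J) auto
  also have "\<dots> < 1" by simp
  finally have small: "(\<Sum>i\<in>I. exp (- (p (fst i) / 2) * n / 4)) < 1" .
  have "\<exists>x. (\<forall>l<n. x l \<in> space M) \<and> (\<forall>i\<in>I. p (fst i) / 2 * n / 4 \<le> card {l. l < n \<and> x l \<in> B i})"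
    using exists_hitting_points[of I B "\<lambda>i. p (fst i) / 2" n] I Bm small by (auto simp: I_def split_beta)
  then obtain x where x: "\<And>l. l < n \<Longrightarrow> x l \<in> space M"
    and hit: "\<And>i. i \<in> I \<Longrightarrow> p (fst i) / 2 * n / 4 \<le> card {l. l < n \<and> x l \<in> B i}" by blast
  have "\<exists>l<n. (1/2) ^ J / 2 < \<bar>\<Sum>a\<in>D. w a * \<psi> a (x l)\<bar>"
    if w: "\<And>a. a \<in> D \<Longrightarrow> 0 \<le> w a" and w1: "sum w D = 1"
      and big: "2 * (1/4) ^ J \<le> (LINT y|M. (\<Sum>a\<in>D. w a * \<psi> a y)\<^sup>2)" for w
  proof -
    define q where "q y = (\<Sum>a\<in>D. w a * \<psi> a y)" for y
    have qm[measurable]: "q \<in> borel_measurable M" unfolding q_def by (intro borel_measurable_sum) auto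
    have q1: "\<bar>q y\<bar> \<le> 1" if "y \<in> space M" for y
    proof -
      have "\<bar>q y\<bar> \<le> (\<Sum>a\<in>D. w a * 1)"
        unfolding q_def using w bd[OF _ that]
        by (intro order_trans[OF sum_abs] sum_mono) (auto simp: abs_mult intro!: mult_left_le)
      then show ?thesis using w1 by simp
    qed
    obtain j where j: "j \<in> {1..J}" and level: "p j \<le> prob {y\<in>space M. (1/2) ^ j < \<bar>q y\<bar>}"
      using exists_large_level[OF qm q1 J] big unfolding p_def q_def by auto
    define s where "s = (1/2) ^ j / (4::real)"
    have s0: "0 \<le> s" by (simp add: s_def)
    obtain \<kappa> where k: "\<kappa> \<in> PiE {..<m j} (\<lambda>_. D)" and
      bad: "prob {y\<in>space M. s \<le> \<bar>g j \<kappa> y - q y\<bar>} +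
        card {l. l < n \<and> s \<le> \<bar>g j \<kappa> (x l) - q (x l)\<bar>} / n \<le> 4 * exp (- real (m j) * s\<^sup>2 / 2)"
      using exists_tuple_average[of D w \<psi> s "m j" n x] D w w1 assms(3) bd s0 m0 n0 x unfolding g_def q_def by auto
    have "real (m j) * s\<^sup>2 / 2 = 9 * real J"
      by (simp add: m_def s_def power2_eq_square field_simps flip: power_mult_distrib)
    then have "4 * exp (- real (m j) * s\<^sup>2 / 2) \<le> (1/4) ^ J / (16 * J)"
      using maurey_tail_le_level_mass[OF J] by simp
    also have "\<dots> \<le> p j / 16"
    proof -
      have "4 * (1/4) ^ J \<le> 4 ^ j * (1/4::real) ^ J"
        using j power_increasing[of 1 j "4::real"] by (intro mult_right_mono) auto
      then show ?thesis using J by (simp add: p_def field_simps)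
    qed
    finally have "4 * exp (- real (m j) * s\<^sup>2 / 2) \<le> p j / 16" .
    with bad have bad': "prob {y\<in>space M. s \<le> \<bar>g j \<kappa> y - q y\<bar>} +
        card {l. l < n \<and> s \<le> \<bar>g j \<kappa> (x l) - q (x l)\<bar>} / n \<le> p j / 16"
      by (rule order_trans)
    have [measurable]: "g j \<kappa> \<in> borel_measurable M" by (rule gm[OF k])
    have "p j \<le> prob {y\<in>space M. (1/2) ^ j < \<bar>q y\<bar>}" by (rule level)
    also have "\<dots> \<le> prob (B (j, \<kappa>) \<union> {y\<in>space M. s \<le> \<bar>g j \<kappa> y - q y\<bar>})"
    proof (intro finite_measure_mono subsetI)
      fix y assume y: "y \<in> {y\<in>space M. (1/2) ^ j < \<bar>q y\<bar>}"
      show "y \<in> B (j, \<kappa>) \<union> {y\<in>space M. s \<le> \<bar>g j \<kappa> y - q y\<bar>}"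
      proof (cases "s \<le> \<bar>g j \<kappa> y - q y\<bar>")
        case False
        then have "\<bar>g j \<kappa> y - q y\<bar> < (1/2) ^ j / 4" by (simp add: s_def)
        moreover have "(1/2) ^ j < \<bar>q y\<bar>" using y by simp
        ultimately have "3/4 * (1/2) ^ j < \<bar>g j \<kappa> y\<bar>" by linarith
        with y show ?thesis by (simp add: B_def)
      qed (use y in simp)
    qed (auto simp: B_def)
    also have "\<dots> \<le> prob (B (j, \<kappa>)) + prob {y\<in>space M. s \<le> \<bar>g j \<kappa> y - q y\<bar>}"
      by (intro measure_Un_le) (auto simp: B_def)
    also have "\<dots> \<le> prob (B (j, \<kappa>)) + p j / 16"
      using bad' by (smt (verit) divide_nonneg_nonneg of_nat_0_le_iff)
    finally have "(j, \<kappa>) \<in> I" using j k p0[of j] by (simp add: I_def)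
    from hit[OF this] have h: "p j * n / 8 \<le> card {l. l < n \<and> x l \<in> B (j, \<kappa>)}" by simp
    have "card {l. l < n \<and> s \<le> \<bar>g j \<kappa> (x l) - q (x l)\<bar>} / n \<le> p j / 16"
      using bad' by (smt (verit) measure_nonneg)
    then have "card {l. l < n \<and> s \<le> \<bar>g j \<kappa> (x l) - q (x l)\<bar>} \<le> p j * n / 16"
      using n0 by (simp add: field_simps)
    also have "\<dots> < p j * n / 8" using p0[of j] n0 by simp
    also note h
    finally have lt: "card {l. l < n \<and> s \<le> \<bar>g j \<kappa> (x l) - q (x l)\<bar>} < card {l. l < n \<and> x l \<in> B (j, \<kappa>)}" by simp
    \<comment> \<open>more points hit the large set of the average than are bad for it\<close>
    have "\<not> {l. l < n \<and> x l \<in> B (j, \<kappa>)} \<subseteq> {l. l < n \<and> s \<le> \<bar>g j \<kappa> (x l) - q (x l)\<bar>}"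
      using card_mono[of "{l. l < n \<and> s \<le> \<bar>g j \<kappa> (x l) - q (x l)\<bar>}" "{l. l < n \<and> x l \<in> B (j, \<kappa>)}"] lt by auto
    then obtain l where l: "l < n" "x l \<in> B (j, \<kappa>)" "\<bar>g j \<kappa> (x l) - q (x l)\<bar> < s" by force
    have "(1/2) ^ J / 2 \<le> (1/2) ^ j / (2::real)"
      using j by (intro divide_right_mono power_decreasing) auto
    also have "\<dots> < \<bar>q (x l)\<bar>"
    proof -
      have "3/4 * (1/2) ^ j < \<bar>g j \<kappa> (x l)\<bar>" using l(2) by (simp add: B_def)
      moreover have "\<bar>g j \<kappa> (x l) - q (x l)\<bar> < (1/2) ^ j / 4" using l(3) by (simp add: s_def)
      ultimately show ?thesis by linarith
    qed
    finally show ?thesis using l(1) by (auto simp: q_def)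
  qed
  with x show ?thesis by (intro exI[of _ x] conjI allI impI) auto
qed

text \<open>
  Signed coefficients are turned into a convex combination over the dictionary with both
  signs. The slack \<open>1 - \<Sum>\<bar>b a\<bar>\<close> is spread evenly over all signed elements, where it
  cancels.
\<close>

lemma (in prob_space) exists_detecting_points:
  fixes \<psi> :: "'i \<Rightarrow> 'a \<Rightarrow> real" and n :: nat
  assumes D: "finite D" and D0: "D \<noteq> {}"
    and meas: "\<And>a. a \<in> D \<Longrightarrow> \<psi> a \<in> borel_measurable M"
    and bd: "\<And>a x. a \<in> D \<Longrightarrow> x \<in> space M \<Longrightarrow> \<bar>\<psi> a x\<bar> \<le> 1"
    and J: "1 \<le> J" and n: "18432 * real J ^ 2 * 4 ^ J * ln (2 * card D) \<le> n"
  shows "\<exists>x. (\<forall>l<n. x l \<in> space M) \<and>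
    (\<forall>b. (\<Sum>a\<in>D. \<bar>b a\<bar>) \<le> 1 \<longrightarrow> 2 * (1/4) ^ J \<le> (LINT y|M. (\<Sum>a\<in>D. b a * \<psi> a y)\<^sup>2) \<longrightarrow>
      (\<exists>l<n. (1/2) ^ J / 2 < \<bar>\<Sum>a\<in>D. b a * \<psi> a (x l)\<bar>))"
proof -
  define E where "E = D \<times> {-1, 1::real}"
  define \<phi> where "\<phi> = (\<lambda>(a, s) y. s * \<psi> a y)"
  have E: "finite E" using D by (simp add: E_def)
  have cE: "card E = 2 * card D" by (simp add: E_def card_cartesian_product)
  have c0: "0 < card D" using D D0 by (simp add: card_gt_0_iff)
  have "\<exists>x. (\<forall>l<n. x l \<in> space M) \<and>
    (\<forall>w. (\<forall>a\<in>E. 0 \<le> w a) \<longrightarrow> sum w E = 1 \<longrightarrow>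
      2 * (1/4) ^ J \<le> (LINT y|M. (\<Sum>a\<in>E. w a * \<phi> a y)\<^sup>2) \<longrightarrow>
      (\<exists>l<n. (1/2) ^ J / 2 < \<bar>\<Sum>a\<in>E. w a * \<phi> a (x l)\<bar>))"
  proof (rule exists_detecting_points_convex[OF E])
    show "2 \<le> card E" using c0 by (simp add: cE)
    show "\<phi> a \<in> borel_measurable M" if "a \<in> E" for a
      using that meas by (auto simp: E_def \<phi>_def)
    show "\<bar>\<phi> a x\<bar> \<le> 1" if "a \<in> E" "x \<in> space M" for a x
      using that bd by (auto simp: E_def \<phi>_def)
    show "18432 * (real J)\<^sup>2 * 4 ^ J * ln (card E) \<le> n" using n by (simp add: cE)
  qed (rule J)
  then obtain x where x: "\<forall>l<n. x l \<in> space M"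
    and det: "\<forall>w. (\<forall>a\<in>E. 0 \<le> w a) \<longrightarrow> sum w E = 1 \<longrightarrow>
      2 * (1/4) ^ J \<le> (LINT y|M. (\<Sum>a\<in>E. w a * \<phi> a y)\<^sup>2) \<longrightarrow>
      (\<exists>l<n. (1/2) ^ J / 2 < \<bar>\<Sum>a\<in>E. w a * \<phi> a (x l)\<bar>)"
    by blast
  have "\<exists>l<n. (1/2) ^ J / 2 < \<bar>\<Sum>a\<in>D. b a * \<psi> a (x l)\<bar>"
    if b: "(\<Sum>a\<in>D. \<bar>b a\<bar>) \<le> 1" and big: "2 * (1/4) ^ J \<le> (LINT y|M. (\<Sum>a\<in>D. b a * \<psi> a y)\<^sup>2)" for b
  proof -
    define \<sigma> where "\<sigma> = (1 - (\<Sum>a\<in>D. \<bar>b a\<bar>)) / (2 * card D)"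
    define w where "w = (\<lambda>(a, s). (\<bar>b a\<bar> + s * b a) / 2 + \<sigma>)"
    have \<sigma>: "0 \<le> \<sigma>" using b by (simp add: \<sigma>_def)
    have sumE: "(\<Sum>a\<in>E. F a) = (\<Sum>a\<in>D. F (a, 1) + F (a, -1))" for F :: "_ \<Rightarrow> real"
        unfolding E_def sum.cartesian_product' by (simp add: add.commute)
    have eq: "(\<Sum>a\<in>E. w a * \<phi> a y) = (\<Sum>a\<in>D. b a * \<psi> a y)" for y
      unfolding sumE by (intro sum.cong) (auto simp: w_def \<phi>_def algebra_simps add_divide_distrib)
    have "sum w E = (\<Sum>a\<in>D. \<bar>b a\<bar> + 2 * \<sigma>)"
      unfolding sumE by (intro sum.cong) (auto simp: w_def field_simps)
    also have "\<dots> = (\<Sum>a\<in>D. \<bar>b a\<bar>) + 2 * card D * \<sigma>" by (simp add: sum.distrib)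
    also have "2 * card D * \<sigma> = 1 - (\<Sum>a\<in>D. \<bar>b a\<bar>)" using c0 by (simp add: \<sigma>_def)
    also have "(\<Sum>a\<in>D. \<bar>b a\<bar>) + (1 - (\<Sum>a\<in>D. \<bar>b a\<bar>)) = 1" by simp
    finally have "sum w E = 1" .
    moreover have "0 \<le> w a" if "a \<in> E" for a
      using that \<sigma> by (auto simp: w_def E_def)
    ultimately show ?thesis
      using det[rule_format, of w] big unfolding eq by simp
  qed
  with x show ?thesis by (intro exI[of _ x] conjI allI impI) auto
qed

section \<open>The cube and its characters\<close>

definition character :: "nat \<Rightarrow> (nat \<Rightarrow> int) \<Rightarrow> (nat \<Rightarrow> real) \<Rightarrow> complex" where
  "character d k x = cis (2 * pi * (\<Sum>i<d. of_int (k i) * x i))"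

lemma norm_character [simp]: "cmod (character d k x) = 1"
  by (simp add: character_def)

lemma fourier_coeff_eq_character:
  "fourier_coeff d f k = (LINT x|cube_measure d. f x * cnj (character d k x))"
proof -
  have "exp (- 2 * of_real pi * \<i> * of_real s) = cnj (cis (2 * pi * s))" for s :: real
    by (simp add: cis_cnj cis_conv_exp exp_cnj mult_ac)
  then show ?thesis by (simp only: fourier_coeff_def character_def)
qed

lemma character_eq_prod: "character d k x = (\<Prod>i<d. cis (2 * pi * (of_int (k i) * x i)))"
  unfolding character_def cis_conv_exp by (simp add: exp_sum sum_distrib_left)

lemma character_mult_cnj: "character d k x * cnj (character d l x) = character d (\<lambda>i. k i - l i) x"
  by (simp add: character_def cis_cnj cis_mult left_diff_distrib right_diff_distrib sum_subtractf)

interpretation unit_interval: prob_space "restrict_space lborel {0..1::real}"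
  by (rule prob_spaceI) (simp add: space_restrict_space emeasure_restrict_space)

interpretation cube: prob_space "cube_measure d" for d
  unfolding cube_measure_def by (intro prob_space_PiM unit_interval.prob_space_axioms)

interpretation unit_intervals: product_sigma_finite "\<lambda>_::nat. restrict_space lborel {0..1::real}"
  by standard

lemma space_cube_measure [simp]: "space (cube_measure d) = unit_cube d"
  by (simp add: cube_measure_def unit_cube_def space_PiM space_restrict_space)

text \<open>
  Writing the cube as a product over all of \<open>nat\<close> makes Tychonoff's theorem applicable.
\<close>

lemma unit_cube_eq: "unit_cube d = PiE UNIV (\<lambda>i. if i < d then {0..1} else {undefined})"
  by (auto simp: unit_cube_def PiE_def extensional_def Pi_def split: if_splits) 

lemma compact_unit_cube: "compact (unit_cube d)"
proof -
  have "compactin (product_topology (\<lambda>_. euclidean) UNIV) (unit_cube d)"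
    unfolding unit_cube_eq compactin_PiE by auto
  then show ?thesis by (simp add: euclidean_product_topology)
qed

lemma continuous_on_coordinate [continuous_intros]: "continuous_on S (\<lambda>x::nat \<Rightarrow> real. x i)"
  by (rule continuous_on_subset[OF continuous_on_product_coordinates]) simp

lemma continuous_on_character: "continuous_on S (character d k)"
  unfolding character_def by (intro continuous_intros)

text \<open>
  The product \<open>\<sigma>\<close>-algebra of the cube measure only knows the first \<open>d\<close> coordinates. The others are
  constant on the cube, so the inclusion into \<open>nat \<Rightarrow> real\<close> with its Borel \<open>\<sigma>\<close>-algebra is
  measurable.
\<close>

lemma borel_measurable_cube_continuous:
  fixes f :: "(nat \<Rightarrow> real) \<Rightarrow> 'b::topological_space"
  assumes f: "continuous_on (unit_cube d) f"
  shows "f \<in> borel_measurable (cube_measure d)"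
proof -
  have "(\<lambda>x. x) \<in> measurable (cube_measure d) (PiM UNIV (\<lambda>_. borel :: real measure))"
  proof (rule measurable_PiM_single')
    fix i :: nat
    show "(\<lambda>x. x i) \<in> measurable (cube_measure d) (borel :: real measure)"
    proof (cases "i < d")
      case True
      have "(\<lambda>x. x i) \<in> measurable (cube_measure d) (restrict_space lborel {0..1::real})"
        unfolding cube_measure_def using True by (intro measurable_component_singleton) simp
      then show ?thesis by (simp add: measurable_restrict_space2_iff)
    next
      case False
      have "(\<lambda>x. undefined) \<in> measurable (cube_measure d) (borel :: real measure)" by simp
      moreover have "x i = undefined" if "x \<in> space (cube_measure d)" for x
        using that False by (auto simp: unit_cube_def PiE_def extensional_def)
      ultimately show ?thesis
        using measurable_cong[of "cube_measure d" "\<lambda>x. x i" "\<lambda>_. undefined" borel] by auto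
    qed
  qed auto
  then have "(\<lambda>x. x) \<in> measurable (cube_measure d) borel"
    by (simp add: sets_PiM_equal_borel cong: measurable_cong_sets)
  then have "(\<lambda>x. x) \<in> measurable (cube_measure d) (restrict_space borel (unit_cube d))"
    by (intro measurable_restrict_space2) auto
  moreover have "f \<in> borel_measurable (restrict_space borel (unit_cube d))"
    by (rule borel_measurable_continuous_on_restrict[OF f])
  ultimately show ?thesis using measurable_compose by blast
qed

lemma continuous_on_cube_bounded:
  fixes f :: "(nat \<Rightarrow> real) \<Rightarrow> 'b::real_normed_vector"
  assumes "continuous_on (unit_cube d) f"
  obtains C where "0 < C" "\<And>x. x \<in> unit_cube d \<Longrightarrow> norm (f x) \<le> C"
proof -
  have "bounded (f ` unit_cube d)"
    by (intro compact_imp_bounded compact_continuous_image assms compact_unit_cube)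
  then show ?thesis using that by (auto simp: bounded_pos)
qed

lemma integrable_cube_continuous:
  fixes f :: "(nat \<Rightarrow> real) \<Rightarrow> 'b::{banach, second_countable_topology}"
  assumes f: "continuous_on (unit_cube d) f"
  shows "integrable (cube_measure d) f"
proof -
  obtain C where "\<And>x. x \<in> unit_cube d \<Longrightarrow> norm (f x) \<le> C"
    using continuous_on_cube_bounded[OF f] by blast
  then show ?thesis
    by (intro cube.integrable_const_bound[where B=C] borel_measurable_cube_continuous f) auto
qed

lemma integrable_unit_interval_continuous:
  fixes f :: "real \<Rightarrow> 'b::{banach, second_countable_topology}"
  assumes f: "continuous_on {0..1} f"
  shows "integrable (restrict_space lborel {0..1}) f"
proof -
  have "bounded (f ` {0..1})" by (intro compact_imp_bounded compact_continuous_image f) auto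
  then obtain C where "\<forall>x\<in>{0..1}. norm (f x) \<le> C" unfolding bounded_iff by auto
  moreover have "f \<in> borel_measurable (restrict_space lborel {0..1})"
    using borel_measurable_continuous_on_restrict[OF f] by (simp cong: measurable_cong_sets sets_restrict_space_cong)
  ultimately show ?thesis
    by (intro unit_interval.integrable_const_bound[where B=C]) (auto simp: space_restrict_space)
qed

lemma integral_cube_prod:
  fixes f :: "nat \<Rightarrow> real \<Rightarrow> 'b::{real_normed_field, banach, second_countable_topology}"
  assumes "\<And>i. i < d \<Longrightarrow> continuous_on {0..1} (f i)"
  shows "(LINT x|cube_measure d. (\<Prod>i<d. f i (x i))) = (\<Prod>i<d. LINT t|restrict_space lborel {0..1}. f i t)"
  unfolding cube_measure_def using assms
  by (intro unit_intervals.product_integral_prod integrable_unit_interval_continuous) auto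

lemma integral_unit_interval_cis:
  "(LINT t|restrict_space lborel {0..1}. cis (2 * pi * (of_int j * t))) = of_bool (j = 0)"
proof (cases "j = 0")
  case True
  then show ?thesis using unit_interval.prob_space by simp
next
  case False
  define c :: complex where "c = 2 * of_real pi * \<i> * of_int j"
  have c: "c \<noteq> 0" using False by (simp add: c_def)
  have e: "cis (2 * pi * (of_int j * t)) = exp (c * of_real t)" for t
    by (simp add: c_def cis_conv_exp exp_cnj mult_ac)
  have der: "((\<lambda>t. exp (c * of_real t) / c) has_vector_derivative exp (c * of_real t)) (at t within S)" for t S
  proof -
    have "((\<lambda>z. exp (c * z) / c) has_field_derivative exp (c * of_real t)) (at (of_real t))"
      using c by (auto intro!: derivative_eq_intros)
    from has_vector_derivative_real_field[OF this] show ?thesis .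
  qed
  have "(LINT t|restrict_space lborel {0..1}. cis (2 * pi * (of_int j * t))) =
      (LINT t|lborel. indicator {0..1} t *\<^sub>R exp (c * of_real t))"
    by (subst integral_restrict_space) (auto simp: e)
  also have "\<dots> = exp (c * of_real 1) / c - exp (c * of_real 0) / c"
    by (rule integral_FTC_Icc) (auto intro!: der continuous_intros)
  also have "exp (c * of_real 1) = 1"
    using cis_multiple_2pi[of "of_int j"] by (simp add: c_def cis_conv_exp exp_cnj mult_ac)
  finally show ?thesis using False by simp
qed

lemma integral_character:
  "(LINT x|cube_measure d. character d k x) = of_bool (\<forall>i<d. k i = 0)"
proof -
  have "(LINT x|cube_measure d. character d k x) = (\<Prod>i<d. LINT t|restrict_space lborel {0..1}. cis (2 * pi * (of_int (k i) * t)))"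
    unfolding character_eq_prod by (rule integral_cube_prod) (intro continuous_intros)
  also have "\<dots> = (\<Prod>i<d. of_bool (k i = 0))" by (simp only: integral_unit_interval_cis)
  also have "\<dots> = of_bool (\<forall>i<d. k i = 0)" by (auto simp: of_bool_def)
  finally show ?thesis .
qed

lemma fourier_coeff_character:
  assumes "k \<in> int_vectors d" "l \<in> int_vectors d"
  shows "fourier_coeff d (character d k) l = of_bool (k = l)"
proof -
  have "(\<forall>i<d. k i - l i = 0) \<longleftrightarrow> k = l"
    using assms by (auto simp: int_vectors_def intro: PiE_ext)
  then show ?thesis
    by (simp add: fourier_coeff_eq_character character_mult_cnj integral_character)
qed

section \<open>Pointwise bounds by Fourier coefficients\<close>

definition bump :: "real \<Rightarrow> real" where "bump t = (1 + cos (2 * pi * t)) / 2"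

lemma bump_nonneg: "0 \<le> bump t" unfolding bump_def using cos_ge_minus_one[of "2 * pi * t"] by (intro divide_nonneg_pos) linarith+

text \<open>
  The integral of \<open>bump ^ n\<close> over a period, see \<open>integral_bump_power\<close>.
\<close>

definition bump_mass :: "nat \<Rightarrow> real" where "bump_mass n = real ((2 * n) choose n) / 4 ^ n"

lemma bump_mass_pos: "0 < bump_mass n" by (simp add: bump_mass_def)

lemma bump_mass_Suc: "bump_mass n - bump_mass (Suc n) = bump_mass n / (2 * (n + 1))"
proof -
  have "(2 * Suc n) choose Suc n = 2 * ((2 * n + 1) choose n)"
    using binomial_symmetric[of "Suc n" "2 * n + 1"] by simp
  moreover have "Suc n * ((2 * n + 1) choose n) = (2 * n + 1) * ((2 * n) choose n)"
    using Suc_times_binomial_eq[of "2 * n" n] binomial_symmetric[of n "2 * n + 1"] by (simp add: mult.commute)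
  ultimately have "(n + 1) * ((2 * Suc n) choose Suc n) = 2 * (2 * n + 1) * ((2 * n) choose n)"
    by (simp add: algebra_simps del: binomial_Suc_Suc)
  then have "real (n + 1) * real ((2 * Suc n) choose Suc n) = 2 * (2 * n + 1) * real ((2 * n) choose n)"
    by (metis of_nat_mult)
  then have eq: "real ((2 * Suc n) choose Suc n) = real ((2 * n) choose n) * (2 * (2 * n + 1) / (n + 1))"
    by (simp add: field_simps del: binomial_Suc_Suc)
  show ?thesis unfolding bump_mass_def eq by (simp add: divide_simps) (simp add: algebra_simps)
qed

text \<open>
  The binomial theorem for \<open>cos (\<pi> t)\<^bsup>2n\<^esup>\<close>, which equals \<open>bump t ^ n\<close>.
\<close>

lemma bump_power_eq:
  "of_real (bump t ^ n) = (\<Sum>j\<le>2*n. of_real (real ((2 * n) choose j) / 4 ^ n) * cis (2 * pi * (of_int (int j - int n) * t)))"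
proof -
  define z where "z = cis (pi * t)"
  have z: "z \<noteq> 0" by (simp add: z_def)
  have "of_real (bump t) = (z * z + 1)^2 / (4 * z * z)"
  proof -
    have "z + cnj z = 2 * of_real (cos (pi * t))" by (simp add: z_def complex_eq_iff)
    moreover have "cnj z * z = 1" by (simp add: z_def cis_cnj cis_mult)
    ultimately have "(z * z + 1) = 2 * of_real (cos (pi * t)) * z" by (metis distrib_right mult.commute)
    moreover have "bump t = cos (pi * t)^2"
      using cos_double_cos[of "pi * t"] by (simp add: bump_def mult_ac)
    ultimately show ?thesis using z by (simp add: field_simps power2_eq_square)
  qed
  then have "of_real (bump t ^ n) = (z * z + 1) ^ (2 * n) / (4 * z * z) ^ n"
    by (simp add: power_divide power_mult)
  also have "(z * z + 1) ^ (2 * n) = (\<Sum>j\<le>2*n. of_nat ((2 * n) choose j) * (z * z) ^ j)"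
    by (simp add: binomial_ring)
  also have "\<dots> / (4 * z * z) ^ n = (\<Sum>j\<le>2*n. of_real (real ((2 * n) choose j) / 4 ^ n) * ((z * z) ^ j / (z * z) ^ n))"
    by (simp add: sum_divide_distrib power_mult_distrib mult.assoc)
  also have "\<dots> = (\<Sum>j\<le>2*n. of_real (real ((2 * n) choose j) / 4 ^ n) * cis (2 * pi * (of_int (int j - int n) * t)))"
  proof (intro sum.cong refl arg_cong2[where f="(*)"])
    fix j
    have "z * z = cis (2 * (pi * t))" by (simp add: z_def cis_mult)
    then have "(z * z) ^ j / (z * z) ^ n = cis (real j * (2 * (pi * t))) / cis (real n * (2 * (pi * t)))"
      by (simp only: Complex.DeMoivre)
    also have "\<dots> = cis (2 * pi * (of_int (int j - int n) * t))"
      by (simp add: cis_divide algebra_simps)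
    finally show "(z * z) ^ j / (z * z) ^ n = cis (2 * pi * (of_int (int j - int n) * t))" .
  qed
  finally show ?thesis .
qed

lemma continuous_on_bump [continuous_intros]:
  "continuous_on S f \<Longrightarrow> continuous_on S (\<lambda>x. bump (f x))"
  unfolding bump_def
  by (intro continuous_on_divide continuous_on_add continuous_on_const)
    (auto intro!: continuous_on_compose2[of UNIV cos] continuous_on_mult continuous_on_const continuous_on_cos continuous_on_id)

lemma integral_bump_power:
  "(LINT t|restrict_space lborel {0..1}. bump (y - t) ^ n) = bump_mass n"
proof -
  let ?M = "restrict_space lborel {0..1::real}"
  let ?c = "\<lambda>j. of_real (real ((2 * n) choose j) / 4 ^ n) * cis (2 * pi * (of_int (int j - int n) * y)) :: complex"
  have "of_real (LINT t|?M. bump (y - t) ^ n) = (LINT t|?M. of_real (bump (y - t) ^ n) :: complex)"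
    by (simp del: of_real_power)
  also have "\<dots> = (LINT t|?M. (\<Sum>j\<le>2*n. ?c j * cis (2 * pi * (of_int (int n - int j) * t))))"
    unfolding bump_power_eq
    by (intro Bochner_Integration.integral_cong sum.cong) (auto simp: mult.assoc cis_mult algebra_simps)
  also have "\<dots> = (\<Sum>j\<le>2*n. ?c j * (LINT t|?M. cis (2 * pi * (of_int (int n - int j) * t))))"
    by (subst Bochner_Integration.integral_sum) (auto intro!: integrable_unit_interval_continuous continuous_intros)
  also have "\<dots> = (\<Sum>j\<le>2*n. if j = n then ?c j else 0)"
    unfolding integral_unit_interval_cis by (intro sum.cong) auto
  also have "\<dots> = of_real (bump_mass n)" by (simp add: bump_mass_def)
  finally show ?thesis using of_real_eq_iff by blast
qed

text \<open>
  An approximate identity that is nonnegative, concentrates at \<open>y\<close> as \<open>n\<close> grows, and is a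
  trigonometric polynomial with nonnegative coefficients.
\<close>

definition cube_kernel :: "nat \<Rightarrow> nat \<Rightarrow> (nat \<Rightarrow> real) \<Rightarrow> (nat \<Rightarrow> real) \<Rightarrow> real" where
  "cube_kernel d n y x = (\<Prod>i<d. bump (y i - x i) ^ n)"

lemma cube_kernel_nonneg: "0 \<le> cube_kernel d n y x"
  unfolding cube_kernel_def by (intro prod_nonneg) (simp add: bump_nonneg)

lemma continuous_on_cube_kernel [continuous_intros]: "continuous_on S (cube_kernel d n y)"
  unfolding cube_kernel_def by (intro continuous_intros)

lemma integral_cube_kernel: "(LINT x|cube_measure d. cube_kernel d n y x) = bump_mass n ^ d"
  unfolding cube_kernel_def
  by (subst integral_cube_prod) (auto intro!: continuous_intros simp: integral_bump_power)

text \<open>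
  The factor \<open>1 - cos\<close> is \<open>2 (1 - bump)\<close>, so the moment is a difference of two consecutive masses
  and gains a factor \<open>1 / (n + 1)\<close>. This is the concentration of the kernel at \<open>y\<close>.
\<close>

lemma integral_cube_kernel_moment:
  assumes l: "l < d"
  shows "(LINT x|cube_measure d. (1 - cos (2 * pi * (y l - x l))) * cube_kernel d n y x) = bump_mass n ^ d / (n + 1)"
proof -
  define f where "f i t = (if i = l then 2 * (bump (y i - t) ^ n - bump (y i - t) ^ Suc n) else bump (y i - t) ^ n)" for i t
  have split: "(\<Prod>i<d. g i) = g l * (\<Prod>i\<in>{..<d} - {l}. g i)" for g :: "nat \<Rightarrow> real"
    using l by (subst prod.remove[of _ l]) auto
  have f: "(1 - cos (2 * pi * (y l - x l))) * cube_kernel d n y x = (\<Prod>i<d. f i (x i))" for x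
  proof -
    have "1 - cos (2 * pi * (y l - x l)) = 2 * (1 - bump (y l - x l))" by (simp add: bump_def field_simps)
    then have "(1 - cos (2 * pi * (y l - x l))) * bump (y l - x l) ^ n = 2 * (1 - bump (y l - x l)) * bump (y l - x l) ^ n"
      by (rule arg_cong)
    also have "\<dots> = f l (x l)" by (simp add: f_def algebra_simps)
    finally have "(1 - cos (2 * pi * (y l - x l))) * bump (y l - x l) ^ n = f l (x l)" .
    moreover have "(\<Prod>i\<in>{..<d} - {l}. bump (y i - x i) ^ n) = (\<Prod>i\<in>{..<d} - {l}. f i (x i))"
      by (intro prod.cong) (auto simp: f_def)
    ultimately show ?thesis unfolding cube_kernel_def split by (simp add: mult.assoc[symmetric])
  qed
  have cont: "continuous_on {0..1} (f i)" for i
    by (cases "i = l") (auto simp: f_def[abs_def] intro!: continuous_intros)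
  have Il: "(LINT t|restrict_space lborel {0..1}. f l t) = bump_mass n / (n + 1)"
  proof -
    have int: "integrable (restrict_space lborel {0..1}) (\<lambda>t. bump (y l - t) ^ k)" for k
      by (intro integrable_unit_interval_continuous continuous_intros)
    have "f l = (\<lambda>t. 2 * (bump (y l - t) ^ n - bump (y l - t) ^ Suc n))" by (auto simp: f_def)
    then have "(LINT t|restrict_space lborel {0..1}. f l t) = 2 * (bump_mass n - bump_mass (Suc n))"
      using int[of n] int[of "Suc n"] integral_bump_power[of "y l" n] integral_bump_power[of "y l" "Suc n"]
      by (simp del: power_Suc)
    then show ?thesis by (simp add: bump_mass_Suc field_simps)
  qed
  have Ii: "(LINT t|restrict_space lborel {0..1}. f i t) = bump_mass n" if "i \<noteq> l" for i
    using that by (simp add: f_def integral_bump_power)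
  have "(LINT x|cube_measure d. (\<Prod>i<d. f i (x i))) = bump_mass n / (n + 1) * (\<Prod>i\<in>{..<d} - {l}. bump_mass n)"
    by (subst integral_cube_prod[OF cont], subst split) (auto simp: Il Ii)
  also have "\<dots> = bump_mass n ^ d / (n + 1)"
    using split[of "\<lambda>_. bump_mass n"] l by simp
  finally show ?thesis by (simp add: f)
qed

definition shifted_freq :: "nat \<Rightarrow> nat \<Rightarrow> (nat \<Rightarrow> nat) \<Rightarrow> nat \<Rightarrow> int" where
  "shifted_freq d n \<kappa> = (\<lambda>i\<in>{..<d}. int (\<kappa> i) - int n)"

text \<open>
  The kernel is a trigonometric polynomial in \<open>x\<close> and all its coefficients are products of binomial
  coefficients, none of which exceeds the central one. So each coefficient is at most the total mass
  of the kernel.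
\<close>

lemma cube_kernel_eq_sum:
  shows "of_real (cube_kernel d n y x) = (\<Sum>\<kappa>\<in>PiE {..<d} (\<lambda>_. {..2*n}).
    of_real (\<Prod>i<d. real ((2 * n) choose (\<kappa> i)) / 4 ^ n) * (character d (shifted_freq d n \<kappa>) y * cnj (character d (shifted_freq d n \<kappa>) x)))"
proof -
  have "of_real (cube_kernel d n y x) = (\<Prod>i<d. of_real (bump (y i - x i) ^ n) :: complex)"
    by (simp add: cube_kernel_def)
  also have "\<dots> = (\<Sum>\<kappa>\<in>PiE {..<d} (\<lambda>_. {..2*n}). \<Prod>i<d. of_real (real ((2 * n) choose (\<kappa> i)) / 4 ^ n) *
      cis (2 * pi * (of_int (int (\<kappa> i) - int n) * (y i - x i))))"
    unfolding bump_power_eq by (subst prod_sum_PiE) auto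
  also have "\<dots> = (\<Sum>\<kappa>\<in>PiE {..<d} (\<lambda>_. {..2*n}).
    of_real (\<Prod>i<d. real ((2 * n) choose (\<kappa> i)) / 4 ^ n) * (character d (shifted_freq d n \<kappa>) y * cnj (character d (shifted_freq d n \<kappa>) x)))"
  proof (intro sum.cong refl)
    fix \<kappa>
    have "(\<Prod>i<d. cis (2 * pi * (of_int (int (\<kappa> i) - int n) * (y i - x i)))) =
        character d (shifted_freq d n \<kappa>) y * cnj (character d (shifted_freq d n \<kappa>) x)"
      unfolding character_eq_prod cnj_prod prod.distrib[symmetric]
      by (intro prod.cong) (auto simp: shifted_freq_def cis_cnj cis_mult algebra_simps)
    then show "(\<Prod>i<d. of_real (real ((2 * n) choose (\<kappa> i)) / 4 ^ n) *
      cis (2 * pi * (of_int (int (\<kappa> i) - int n) * (y i - x i)))) =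
      of_real (\<Prod>i<d. real ((2 * n) choose (\<kappa> i)) / 4 ^ n) * (character d (shifted_freq d n \<kappa>) y * cnj (character d (shifted_freq d n \<kappa>) x))"
      by (simp only: of_real_prod prod.distrib)
  qed
  finally show ?thesis .
qed

lemma norm_integral_cube_kernel_le:
  assumes h: "continuous_on (unit_cube d) h"
    and B: "\<And>S. finite S \<Longrightarrow> S \<subseteq> int_vectors d \<Longrightarrow> (\<Sum>k\<in>S. cmod (fourier_coeff d h k)) \<le> B"
  shows "cmod (LINT x|cube_measure d. h x * of_real (cube_kernel d n y x)) \<le> bump_mass n ^ d * B"
proof -
  define freq where "freq = shifted_freq d n"
  define c where "c \<kappa> = (\<Prod>i<d. real ((2 * n) choose (\<kappa> i)) / 4 ^ n)" for \<kappa> :: "nat \<Rightarrow> nat"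
  define K where "K = PiE {..<d} (\<lambda>_. {..2*n})"
  have K: "finite K" unfolding K_def by (intro finite_PiE) auto
  have c: "0 \<le> c \<kappa>" "c \<kappa> \<le> bump_mass n ^ d" for \<kappa>
  proof -
    show "0 \<le> c \<kappa>" unfolding c_def by (intro prod_nonneg) auto
    have "c \<kappa> \<le> (\<Prod>i<d. bump_mass n)"
      unfolding c_def bump_mass_def
      by (intro prod_mono conjI divide_right_mono of_nat_mono binomial_maximum') auto
    then show "c \<kappa> \<le> bump_mass n ^ d" by simp
  qed
  have inj: "inj_on freq K"
  proof (rule inj_onI)
    fix a b assume a: "a \<in> K" and b: "b \<in> K" and e: "freq a = freq b"
    have "a i = b i" if "i < d" for i
      using fun_cong[OF e, of i] that by (simp add: freq_def shifted_freq_def)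
    then show "a = b" using a b unfolding K_def by (intro PiE_ext) auto
  qed
  have "(LINT x|cube_measure d. h x * of_real (cube_kernel d n y x)) =
      (LINT x|cube_measure d. (\<Sum>\<kappa>\<in>K. of_real (c \<kappa>) * character d (freq \<kappa>) y * (h x * cnj (character d (freq \<kappa>) x))))"
    unfolding cube_kernel_eq_sum c_def[symmetric] freq_def[symmetric] K_def[symmetric]
    by (simp add: sum_distrib_left mult_ac)
  also have "\<dots> = (\<Sum>\<kappa>\<in>K. of_real (c \<kappa>) * character d (freq \<kappa>) y * fourier_coeff d h (freq \<kappa>))"
    unfolding fourier_coeff_eq_character
    by (subst Bochner_Integration.integral_sum)
      (auto intro!: integrable_cube_continuous continuous_intros h continuous_on_character)
  also have "cmod \<dots> \<le> (\<Sum>\<kappa>\<in>K. bump_mass n ^ d * cmod (fourier_coeff d h (freq \<kappa>)))"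
    using c by (intro sum_norm_le) (auto simp: norm_mult intro!: mult_right_mono)
  also have "\<dots> = bump_mass n ^ d * (\<Sum>k\<in>freq ` K. cmod (fourier_coeff d h k))"
    by (simp add: sum_distrib_left sum.reindex[OF inj])
  also have "\<dots> \<le> bump_mass n ^ d * B"
    using K by (intro mult_left_mono B)
      (auto simp: freq_def shifted_freq_def int_vectors_def PiE_def less_imp_le[OF bump_mass_pos])
  finally show ?thesis .
qed

text \<open>
  Korovkin's argument: integrate the bound \<open>\<bar>h x - h y\<bar> \<le> e / 2 + C S(x)\<close> with
  \<open>S(x) = \<Sum>\<^sub>i (1 - cos (2 \<pi> (y\<^sub>i - x\<^sub>i)))\<close> against the kernel and let \<open>n\<close> grow. The function \<open>S\<close> vanishes
  on the cube only at \<open>y\<close>; this uses that \<open>y\<close> is interior, since opposite faces are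
  identified by \<open>S\<close>.
\<close>

lemma norm_le_fourier_sum_interior:
  assumes h: "continuous_on (unit_cube d) h"
    and B: "\<And>S. finite S \<Longrightarrow> S \<subseteq> int_vectors d \<Longrightarrow> (\<Sum>k\<in>S. cmod (fourier_coeff d h k)) \<le> B"
    and y: "y \<in> unit_cube d" "\<And>i. i < d \<Longrightarrow> 0 < y i \<and> y i < 1"
  shows "cmod (h y) \<le> B"
proof (rule field_le_epsilon)
  fix e :: real assume e: "0 < e"
  \<comment> \<open>the Korovkin test function\<close>
  define S where "S x = (\<Sum>i<d. 1 - cos (2 * pi * (y i - x i)))" for x
  have S0: "0 \<le> S x" for x unfolding S_def by (intro sum_nonneg) simp
  have contS: "continuous_on X S" for X unfolding S_def by (intro continuous_intros)
  have Spos: "0 < S x" if x: "x \<in> unit_cube d" "x \<noteq> y" for x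
  proof -
    obtain i where i: "i < d" "x i \<noteq> y i" 
      using x y(1) by (metis PiE_ext lessThan_iff unit_cube_def)
    have x01: "0 \<le> x i" "x i \<le> 1" using x(1) i by (auto simp: unit_cube_def PiE_def Pi_def)
    have "cos (2 * pi * (y i - x i)) \<noteq> 1"
    proof
      assume "cos (2 * pi * (y i - x i)) = 1"
      then obtain m :: int where "2 * pi * (y i - x i) = of_int m * 2 * pi"
        by (auto simp: cos_one_2pi_int)
      then have "y i - x i = of_int m" by simp
      moreover have "-1 < y i - x i" "y i - x i < 1" using y(2)[OF i(1)] x01 by auto
      ultimately have "m = 0" by linarith
      with \<open>y i - x i = of_int m\<close> i(2) show False by simp
    qed
    then have "0 < 1 - cos (2 * pi * (y i - x i))" using cos_le_one[of "2 * pi * (y i - x i)"] by linarith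
    then show ?thesis unfolding S_def using i(1) by (intro sum_pos2[of _ i]) auto
  qed
  obtain C where C0: "0 \<le> C" and C: "\<And>x. x \<in> unit_cube d \<Longrightarrow> cmod (h x - h y) \<le> e / 2 + C * S x"
  proof -
    have contD: "continuous_on (unit_cube d) (\<lambda>x. cmod (h x - h y))"
      by (intro continuous_intros h)
    obtain D where D: "0 < D" "\<And>x. x \<in> unit_cube d \<Longrightarrow> cmod (h x - h y) \<le> D"
      using continuous_on_cube_bounded[OF contD] by auto
    define Z where "Z = {x\<in>unit_cube d. e / 2 \<le> cmod (h x - h y)}"
    have "closed (unit_cube d \<inter> (\<lambda>x. cmod (h x - h y)) -` {e / 2..})"
      by (intro continuous_closed_preimage contD compact_imp_closed compact_unit_cube closed_atLeast)
    also have "unit_cube d \<inter> (\<lambda>x. cmod (h x - h y)) -` {e / 2..} = Z" by (auto simp: Z_def)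
    finally have "compact (unit_cube d \<inter> Z)" by (intro compact_Int_closed compact_unit_cube)
    also have "unit_cube d \<inter> Z = Z" by (auto simp: Z_def)
    finally have Z: "compact Z" .
    obtain s where s: "0 < s" "\<And>x. x \<in> Z \<Longrightarrow> s \<le> S x"
    proof (cases "Z = {}")
      case True
      then show ?thesis using that[of 1] by auto
    next
      case False
      obtain x where x: "x \<in> Z" "\<And>x'. x' \<in> Z \<Longrightarrow> S x \<le> S x'"
        using continuous_attains_inf[OF Z False contS] by blast
      have "x \<noteq> y" using x(1) e by (auto simp: Z_def)
      then show ?thesis using that[of "S x"] x Spos by (auto simp: Z_def)
    qed
    have "cmod (h x - h y) \<le> e / 2 + D / s * S x" if x: "x \<in> unit_cube d" for x
    proof (cases "x \<in> Z")
      case True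
      have "cmod (h x - h y) \<le> D / s * s" using D(2)[OF x] s by simp
      also have "\<dots> \<le> D / s * S x" using D s True by (intro mult_left_mono) auto
      finally show ?thesis using e by simp
    next
      case False
      then have "cmod (h x - h y) \<le> e / 2" using x by (auto simp: Z_def)
      moreover have "0 \<le> D / s * S x" using D s S0 by simp
      ultimately show ?thesis by linarith
    qed
    then show ?thesis using that[of "D / s"] D s by auto
  qed
  obtain n :: nat where "2 * C * d / e < n"
    using reals_Archimedean2 by blast
  then have n: "2 * C * d / e < real n + 1" by simp
  have pos: "0 < bump_mass n ^ d" using bump_mass_pos[of n] by simp
  let ?k = "cube_kernel d n y"
  have ck: "continuous_on (unit_cube d) (\<lambda>x. of_real (?k x) :: complex)"
    by (intro continuous_intros)
  have eq: "h y * of_real (bump_mass n ^ d) = (LINT x|cube_measure d. h x * of_real (?k x)) - (LINT x|cube_measure d. (h x - h y) * of_real (?k x))"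
  proof -
    have "(LINT x|cube_measure d. h x * of_real (?k x)) - (LINT x|cube_measure d. (h x - h y) * of_real (?k x)) =
       (LINT x|cube_measure d. h y * of_real (?k x))"
      by (subst Bochner_Integration.integral_diff[symmetric])
        (auto intro!: integrable_cube_continuous continuous_intros h ck simp: algebra_simps)
    also have "\<dots> = h y * of_real (LINT x|cube_measure d. ?k x)"
      by (simp del: of_real_prod)
    finally show ?thesis by (simp add: integral_cube_kernel)
  qed
  have "cmod (LINT x|cube_measure d. (h x - h y) * of_real (?k x)) \<le> (LINT x|cube_measure d. cmod ((h x - h y) * of_real (?k x)))"
    by (rule integral_norm_bound)
  also have "\<dots> \<le> (LINT x|cube_measure d. e / 2 * ?k x + C * (\<Sum>i<d. (1 - cos (2 * pi * (y i - x i))) * ?k x))"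
  proof (rule integral_mono)
    show "integrable (cube_measure d) (\<lambda>x. cmod ((h x - h y) * of_real (?k x)))"
      by (intro integrable_cube_continuous continuous_intros h ck)
    show "integrable (cube_measure d) (\<lambda>x. e / 2 * ?k x + C * (\<Sum>i<d. (1 - cos (2 * pi * (y i - x i))) * ?k x))"
      by (intro integrable_cube_continuous continuous_intros)
    fix x assume "x \<in> space (cube_measure d)"
    then have "cmod (h x - h y) * ?k x \<le> (e / 2 + C * S x) * ?k x"
      by (intro mult_right_mono C) (auto simp: cube_kernel_nonneg)
    also have "(e / 2 + C * S x) * ?k x = e / 2 * ?k x + C * (\<Sum>i<d. (1 - cos (2 * pi * (y i - x i))) * ?k x)"
      unfolding S_def sum_distrib_right[symmetric] by (simp only: distrib_right mult.assoc)
    finally show "cmod ((h x - h y) * of_real (?k x)) \<le> e / 2 * ?k x + C * (\<Sum>i<d. (1 - cos (2 * pi * (y i - x i))) * ?k x)"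
      by (simp only: norm_mult norm_of_real abs_of_nonneg[OF cube_kernel_nonneg])
  qed
  also have "\<dots> = e / 2 * bump_mass n ^ d + C * (\<Sum>i<d. bump_mass n ^ d / (n + 1))"
  proof (subst Bochner_Integration.integral_add)
    have "(LINT x|cube_measure d. (\<Sum>i<d. (1 - cos (2 * pi * (y i - x i))) * ?k x)) =
        (\<Sum>i<d. LINT x|cube_measure d. (1 - cos (2 * pi * (y i - x i))) * ?k x)"
      by (intro Bochner_Integration.integral_sum integrable_cube_continuous continuous_intros)
    also have "\<dots> = (\<Sum>i<d. bump_mass n ^ d / (n + 1))"
      by (intro sum.cong) (auto simp: integral_cube_kernel_moment)
    finally show "(LINT x|cube_measure d. e / 2 * ?k x) +
        (LINT x|cube_measure d. C * (\<Sum>i<d. (1 - cos (2 * pi * (y i - x i))) * ?k x)) =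
        e / 2 * bump_mass n ^ d + C * (\<Sum>i<d. bump_mass n ^ d / (n + 1))"
      by (simp only: integral_mult_right_zero integral_cube_kernel)
  qed (intro integrable_cube_continuous continuous_intros)+
  also have "\<dots> = (e / 2 + C * d / (n + 1)) * bump_mass n ^ d" by (simp add: field_simps)
  also have "\<dots> \<le> e * bump_mass n ^ d"
  proof (rule mult_right_mono)
    have "C * d / (n + 1) \<le> e / 2" using n e by (simp add: field_simps)
    then show "e / 2 + C * d / (n + 1) \<le> e" by linarith
  qed (use pos in simp)
  finally have 1: "cmod (LINT x|cube_measure d. (h x - h y) * of_real (?k x)) \<le> e * bump_mass n ^ d" .
  have "cmod (h y) * bump_mass n ^ d = cmod (h y * of_real (bump_mass n ^ d))"
    using pos by (simp add: norm_mult norm_power less_imp_le[OF bump_mass_pos])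
  also have "\<dots> \<le> bump_mass n ^ d * B + e * bump_mass n ^ d"
    unfolding eq using norm_integral_cube_kernel_le[OF h B, of n y] 1
    by (intro order_trans[OF norm_triangle_ineq4] add_mono) auto
  also have "\<dots> = (B + e) * bump_mass n ^ d" by (simp add: algebra_simps)
  finally show "cmod (h y) \<le> B + e" using pos by simp
qed

text \<open>
  Boundary points, where \<open>h\<close> may differ from its periodic extension, are reached along the segment
  from the centre of the cube by continuity.
\<close>

lemma norm_le_fourier_sum:
  assumes h: "continuous_on (unit_cube d) h"
    and B: "\<And>S. finite S \<Longrightarrow> S \<subseteq> int_vectors d \<Longrightarrow> (\<Sum>k\<in>S. cmod (fourier_coeff d h k)) \<le> B"
    and y: "y \<in> unit_cube d"
  shows "cmod (h y) \<le> B"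
proof -
  define \<gamma> where "\<gamma> t i = (if i < d then y i + (1/2 - y i) * t else undefined)" for t i
  have cont: "continuous_on UNIV \<gamma>"
  proof (rule continuous_on_coordinatewise_then_product)
    show "continuous_on UNIV (\<lambda>t. \<gamma> t i)" for i
      by (cases "i < d") (auto simp: \<gamma>_def intro!: continuous_intros)
  qed
  have y01: "0 \<le> y i" "y i \<le> 1" if "i < d" for i using y that by (auto simp: unit_cube_def PiE_def Pi_def)
  have \<gamma>0: "\<gamma> 0 = y" using y by (auto simp: \<gamma>_def unit_cube_def PiE_def extensional_def)
  define t where "t m = 1 / real (m + 2)" for m
  have t: "0 < t m" "t m < 1" for m by (auto simp: t_def)
  have zi: "0 < \<gamma> (t m) i \<and> \<gamma> (t m) i < 1" if i: "i < d" for i m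
  proof -
    have "\<gamma> (t m) i = (1 - t m) * y i + t m / 2" using i by (simp add: \<gamma>_def algebra_simps)
    moreover have "0 \<le> (1 - t m) * y i" using t[of m] y01[OF i] by simp
    moreover have "(1 - t m) * y i \<le> (1 - t m)" using t[of m] y01[OF i] by (intro mult_left_le) auto
    ultimately show ?thesis using t[of m] by linarith
  qed
  have zc: "\<gamma> (t m) \<in> unit_cube d" for m
    using zi[of _ m] by (auto simp: unit_cube_def PiE_def Pi_def extensional_def less_imp_le) (simp add: \<gamma>_def)
  have "t \<longlonglongrightarrow> 0"
    unfolding t_def by (rule LIMSEQ_ignore_initial_segment[OF lim_1_over_n])
  then have "(\<lambda>m. \<gamma> (t m)) \<longlonglongrightarrow> \<gamma> 0"
    by (rule continuous_on_tendsto_compose[OF cont]) auto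
  then have "(\<lambda>m. h (\<gamma> (t m))) \<longlonglongrightarrow> h y"
    using zc y unfolding \<gamma>0 by (intro continuous_on_tendsto_compose[OF h]) auto
  then have "(\<lambda>m. cmod (h (\<gamma> (t m)))) \<longlonglongrightarrow> cmod (h y)" by (rule tendsto_norm)
  then show ?thesis
    by (rule LIMSEQ_le_const2) (use norm_le_fourier_sum_interior[OF h B zc zi] in blast)
qed

section \<open>Truncation of the Fourier series\<close>

lemma fourier_coeff_diff:
  assumes "continuous_on (unit_cube d) f" "continuous_on (unit_cube d) g"
  shows "fourier_coeff d (\<lambda>x. f x - g x) k = fourier_coeff d f k - fourier_coeff d g k"
  unfolding fourier_coeff_eq_character left_diff_distrib
  by (intro Bochner_Integration.integral_diff integrable_cube_continuous continuous_intros assms continuous_on_character)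

lemma fourier_coeff_trig_polynomial:
  assumes S: "finite S" "S \<subseteq> int_vectors d" and l: "l \<in> int_vectors d"
  shows "fourier_coeff d (\<lambda>x. \<Sum>k\<in>S. a k * character d k x) l = (if l \<in> S then a l else 0)"
proof -
  have "fourier_coeff d (\<lambda>x. \<Sum>k\<in>S. a k * character d k x) l = (\<Sum>k\<in>S. a k * fourier_coeff d (character d k) l)"
    unfolding fourier_coeff_eq_character sum_distrib_right mult.assoc
    by (subst Bochner_Integration.integral_sum)
      (auto intro!: integrable_cube_continuous continuous_intros continuous_on_character)
  also have "\<dots> = (\<Sum>k\<in>S. if k = l then a k else 0)"
    using S l by (intro sum.cong) (auto simp: fourier_coeff_character subset_iff)
  finally show ?thesis using S by simp
qed

lemma log_weight_ge_1: "1 \<le> log_weight d k"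
  by (simp add: log_weight_def)

lemma log_weight_nonneg [simp]: "0 \<le> log_weight d k"
  using log_weight_ge_1[of d k] by linarith

text \<open>
  The ball of radius \<open>R\<close> of the space behind \<open>F_log\<close>, with the infinite sum replaced by a bound
  on all finite partial sums.
\<close>

definition log_wiener_le :: "nat \<Rightarrow> real \<Rightarrow> ((nat \<Rightarrow> real) \<Rightarrow> complex) \<Rightarrow> bool" where
  "log_wiener_le d R h \<longleftrightarrow> continuous_on (unit_cube d) h \<and>
    (\<forall>S. finite S \<longrightarrow> S \<subseteq> int_vectors d \<longrightarrow> (\<Sum>k\<in>S. cmod (fourier_coeff d h k) * log_weight d k) \<le> R)"

lemma log_wiener_le_F_log:
  assumes "f \<in> F_log d"
  shows "log_wiener_le d 1 f"
proof -
  have "(\<Sum>k\<in>S. cmod (fourier_coeff d f k) * log_weight d k) \<le> 1" if "finite S" "S \<subseteq> int_vectors d" for S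
  proof -
    have "(\<Sum>k\<in>S. cmod (fourier_coeff d f k) * log_weight d k) \<le>
        (\<Sum>\<^sub>\<infinity>k\<in>int_vectors d. cmod (fourier_coeff d f k) * log_weight d k)"
      using assms that by (intro finite_sum_le_infsum) (auto simp: F_log_def)
    also have "\<dots> \<le> 1" using assms by (simp add: F_log_def)
    finally show ?thesis .
  qed
  then show ?thesis using assms by (simp add: log_wiener_le_def F_log_def)
qed

lemma log_wiener_le_diff:
  assumes f: "log_wiener_le d R f" and g: "log_wiener_le d R' g"
  shows "log_wiener_le d (R + R') (\<lambda>x. f x - g x)"
  unfolding log_wiener_le_def
proof (intro conjI allI impI)
  have cf: "continuous_on (unit_cube d) f" and cg: "continuous_on (unit_cube d) g"
    using f g by (auto simp: log_wiener_le_def)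
  then show "continuous_on (unit_cube d) (\<lambda>x. f x - g x)" by (rule continuous_on_diff)
  fix S assume S: "finite S" "S \<subseteq> int_vectors d"
  have "(\<Sum>k\<in>S. cmod (fourier_coeff d (\<lambda>x. f x - g x) k) * log_weight d k) \<le>
      (\<Sum>k\<in>S. cmod (fourier_coeff d f k) * log_weight d k + cmod (fourier_coeff d g k) * log_weight d k)"
    unfolding fourier_coeff_diff[OF cf cg] distrib_right[symmetric]
    by (intro sum_mono mult_right_mono norm_triangle_ineq4) simp
  also have "\<dots> \<le> R + R'"
    using f g S unfolding sum.distrib log_wiener_le_def by (intro add_mono) auto
  finally show "(\<Sum>k\<in>S. cmod (fourier_coeff d (\<lambda>x. f x - g x) k) * log_weight d k) \<le> R + R'" .
qed

definition low_freqs :: "nat \<Rightarrow> nat \<Rightarrow> (nat \<Rightarrow> int) set" where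
  "low_freqs d m = PiE {..<d} (\<lambda>_. {- int m..int m})"

lemma finite_low_freqs: "finite (low_freqs d m)"
  unfolding low_freqs_def by (intro finite_PiE) auto

lemma card_low_freqs: "card (low_freqs d m) = (2 * m + 1) ^ d"
  unfolding low_freqs_def by (simp add: card_PiE nat_add_distrib nat_mult_distrib algebra_simps)

lemma low_freqs_subset: "low_freqs d m \<subseteq> int_vectors d"
  by (auto simp: low_freqs_def int_vectors_def PiE_def)

lemma log_weight_high_freq:
  assumes k: "k \<in> int_vectors d" "k \<notin> low_freqs d m" and m: "1 \<le> m"
  shows "ln m \<le> log_weight d k"
proof -
  obtain i where i: "i < d" "int m < \<bar>k i\<bar>"
    using k by (fastforce simp: low_freqs_def int_vectors_def PiE_def Pi_def)
  have "\<bar>k i\<bar> \<le> sup_norm d k"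
    unfolding sup_norm_def using i by (intro Max_ge) auto
  with i have s: "int m < sup_norm d k" by simp
  then have "ln (real m) \<le> ln (of_int (sup_norm d k))" using m by (subst ln_le_cancel_iff) auto
  also have "\<dots> \<le> log_weight d k" using s by (simp add: log_weight_def)
  finally show ?thesis .
qed

text \<open>
  The remainder has the Fourier coefficients of \<open>h\<close> outside the box of low frequencies, where
  the weight is at least \<open>ln m\<close>.
\<close>

lemma dist_partial_fourier_sum:
  assumes h: "log_wiener_le d R h" and m: "2 \<le> m" and y: "y \<in> unit_cube d"
  shows "cmod (h y - (\<Sum>k\<in>low_freqs d m. fourier_coeff d h k * character d k y)) \<le> R / ln m"
proof (rule norm_le_fourier_sum[OF _ _ y])
  have ch: "continuous_on (unit_cube d) h" using h by (simp add: log_wiener_le_def)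
  let ?P = "\<lambda>y. \<Sum>k\<in>low_freqs d m. fourier_coeff d h k * character d k y"
  have cP: "continuous_on (unit_cube d) ?P" by (intro continuous_intros continuous_on_character)
  show "continuous_on (unit_cube d) (\<lambda>y. h y - ?P y)" by (intro continuous_intros ch cP)
  have lnm: "0 < ln (real m)" using m by simp
  fix S assume S: "finite S" "S \<subseteq> int_vectors d"
  have "(\<Sum>k\<in>S. cmod (fourier_coeff d (\<lambda>y. h y - ?P y) k)) \<le> (\<Sum>k\<in>S. cmod (fourier_coeff d h k) * log_weight d k / ln m)"
  proof (rule sum_mono)
    fix k assume "k \<in> S"
    then have k: "k \<in> int_vectors d" using S by blast
    have e: "fourier_coeff d (\<lambda>y. h y - ?P y) k = (if k \<in> low_freqs d m then 0 else fourier_coeff d h k)"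
      unfolding fourier_coeff_diff[OF ch cP]
      by (subst fourier_coeff_trig_polynomial[OF finite_low_freqs low_freqs_subset k]) auto
    show "cmod (fourier_coeff d (\<lambda>y. h y - ?P y) k) \<le> cmod (fourier_coeff d h k) * log_weight d k / ln m"
    proof (cases "k \<in> low_freqs d m")
      case True
      then show ?thesis unfolding e using lnm by simp
    next
      case False
      have "cmod (fourier_coeff d h k) * ln m \<le> cmod (fourier_coeff d h k) * log_weight d k"
        using m by (intro mult_left_mono log_weight_high_freq k False) auto
      with False lnm show ?thesis unfolding e by (simp add: field_simps)
    qed
  qed
  also have "\<dots> \<le> R / ln m"
    using h S lnm unfolding sum_divide_distrib[symmetric] log_wiener_le_def by (intro divide_right_mono) auto
  finally show "(\<Sum>k\<in>S. cmod (fourier_coeff d (\<lambda>y. h y - ?P y) k)) \<le> R / ln m" .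
qed

lemma sum_fourier_le:
  assumes h: "log_wiener_le d R h" and S: "finite S" "S \<subseteq> int_vectors d"
  shows "(\<Sum>k\<in>S. cmod (fourier_coeff d h k)) \<le> R"
proof -
  have "(\<Sum>k\<in>S. cmod (fourier_coeff d h k)) \<le> (\<Sum>k\<in>S. cmod (fourier_coeff d h k) * log_weight d k)"
    using log_weight_ge_1[of d] by (intro sum_mono) (simp add: mult_le_cancel_left1)
  also have "\<dots> \<le> R" using h S by (simp add: log_wiener_le_def)
  finally show ?thesis .
qed

section \<open>Uniqueness up to small error and the complexity bound\<close>

text \<open>
  If \<open>h\<close> vanishes at the points, its partial sum \<open>P\<close> is there as small as the tail, so the detecting
  points bound the \<open>L\<^sub>2\<close> norm of \<open>Re P\<close> and of \<open>Im P = Re (-\<i> P)\<close>. The dictionary consists of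
  the real and imaginary parts of the characters, and the division by \<open>4\<close> normalises the
  \<open>\<ell>\<^sub>1\<close> norm of the coefficients of \<open>P\<close>.
\<close>

lemma exists_uniqueness_points:
  assumes d: "1 \<le> d" and J: "1 \<le> J" and m: "2 \<le> m" and lnm: "2 ^ J \<le> ln (real m)"
    and n: "18432 * real J ^ 2 * 4 ^ J * ln (4 * (2 * real m + 1) ^ d) \<le> real n"
  shows "\<exists>x. (\<forall>l<n. x l \<in> unit_cube d) \<and>
    (\<forall>h. log_wiener_le d 2 h \<longrightarrow> (\<forall>l<n. h (x l) = 0) \<longrightarrow>
      (LINT y|cube_measure d. (cmod (h y))\<^sup>2) \<le> 256 * (1/4) ^ J)"
proof -
  define S where "S = low_freqs d m"
  define D where "D = S \<times> (UNIV :: bool set)"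
  define \<psi> where "\<psi> = (\<lambda>(k, b) y. if b then Re (character d k y) else Im (character d k y))"
  have S: "finite S" "S \<subseteq> int_vectors d" by (simp_all add: S_def finite_low_freqs low_freqs_subset)
  have D: "finite D" using S by (simp add: D_def)
  have cD: "card D = 2 * (2 * m + 1) ^ d"
    by (simp add: D_def S_def card_cartesian_product card_low_freqs)
  have cont_\<psi>: "continuous_on (unit_cube d) (\<psi> a)" for a
    by (cases a; cases "snd a") (auto simp: \<psi>_def intro!: continuous_intros continuous_on_character)
  have "\<exists>x. (\<forall>l<n. x l \<in> space (cube_measure d)) \<and>
    (\<forall>b. (\<Sum>a\<in>D. \<bar>b a\<bar>) \<le> 1 \<longrightarrow> 2 * (1/4) ^ J \<le> (LINT y|cube_measure d. (\<Sum>a\<in>D. b a * \<psi> a y)\<^sup>2) \<longrightarrow>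
      (\<exists>l<n. (1/2) ^ J / 2 < \<bar>\<Sum>a\<in>D. b a * \<psi> a (x l)\<bar>))"
  proof (rule prob_space.exists_detecting_points[OF cube.prob_space_axioms D _ _ _ J])
    have "card D \<noteq> 0" by (simp add: cD)
    then show "D \<noteq> {}" by auto
    show "\<psi> a \<in> borel_measurable (cube_measure d)" for a
      by (rule borel_measurable_cube_continuous[OF cont_\<psi>])
    show "\<bar>\<psi> a y\<bar> \<le> 1" for a y
    proof (cases a)
      case (Pair k b)
      show ?thesis
        using abs_Re_le_cmod[of "character d k y"] abs_Im_le_cmod[of "character d k y"]
        by (simp add: Pair \<psi>_def)
    qed
    show "18432 * (real J)\<^sup>2 * 4 ^ J * ln (real (2 * card D)) \<le> real n"
      using n by (simp add: cD add.commute)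
  qed
  then obtain x where x: "\<And>l. l < n \<Longrightarrow> x l \<in> unit_cube d"
    and det: "\<And>b. (\<Sum>a\<in>D. \<bar>b a\<bar>) \<le> 1 \<Longrightarrow> 2 * (1/4) ^ J \<le> (LINT y|cube_measure d. (\<Sum>a\<in>D. b a * \<psi> a y)\<^sup>2) \<Longrightarrow>
      (\<exists>l<n. (1/2) ^ J / 2 < \<bar>\<Sum>a\<in>D. b a * \<psi> a (x l)\<bar>)"
    by auto
  have "(LINT y|cube_measure d. (cmod (h y))\<^sup>2) \<le> 256 * (1/4) ^ J"
    if h: "log_wiener_le d 2 h" and zero: "\<And>l. l < n \<Longrightarrow> h (x l) = 0" for h
  proof -
    define P where "P y = (\<Sum>k\<in>S. fourier_coeff d h k * character d k y)" for y
    have ch: "continuous_on (unit_cube d) h" using h by (simp add: log_wiener_le_def)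
    have cP: "continuous_on (unit_cube d) P"
      unfolding P_def by (intro continuous_intros continuous_on_character)
    have tail: "cmod (h y - P y) \<le> 2 * (1/2) ^ J" if "y \<in> unit_cube d" for y
    proof -
      have "cmod (h y - P y) \<le> 2 / ln m"
        unfolding P_def S_def by (rule dist_partial_fourier_sum[OF h m that])
      also have "\<dots> \<le> 2 / 2 ^ J" using lnm by (intro divide_left_mono) (auto intro!: mult_pos_pos less_le_trans[OF _ lnm])
      finally show ?thesis by (simp add: power_divide)
    qed
    have part: "(LINT y|cube_measure d. (Re (u * P y) / 4)\<^sup>2) \<le> 2 * (1/4) ^ J" if u: "cmod u = 1" for u
    proof (rule ccontr)
      assume neg: "\<not> ?thesis"
      define b where "b = (\<lambda>(k, c). if c then Re (u * fourier_coeff d h k) / 4 else - Im (u * fourier_coeff d h k) / 4)"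
      have sumD: "(\<Sum>a\<in>D. F a) = (\<Sum>k\<in>S. F (k, True) + F (k, False))" for F :: "_ \<Rightarrow> real"
        unfolding D_def sum.cartesian_product' by (simp add: UNIV_bool add.commute)
      have eq: "(\<Sum>a\<in>D. b a * \<psi> a y) = Re (u * P y) / 4" for y
        unfolding sumD P_def
        unfolding sum_distrib_left Re_sum sum_divide_distrib
        by (intro sum.cong) (auto simp: b_def \<psi>_def field_simps)
      have "(\<Sum>a\<in>D. \<bar>b a\<bar>) \<le> (\<Sum>k\<in>S. cmod (fourier_coeff d h k) / 2)"
        unfolding sumD
      proof (rule sum_mono)
        fix k
        have "cmod (u * fourier_coeff d h k) = cmod (fourier_coeff d h k)" using u by (simp add: norm_mult)
        moreover have "\<bar>Re v / 4\<bar> + \<bar>- Im v / 4\<bar> \<le> cmod v / 2" for v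
          using abs_Re_le_cmod[of v] abs_Im_le_cmod[of v] by simp
        ultimately show "\<bar>b (k, True)\<bar> + \<bar>b (k, False)\<bar> \<le> cmod (fourier_coeff d h k) / 2"
          by (simp only: b_def prod.case if_True if_False) metis
      qed
      also have "\<dots> \<le> 1" using sum_fourier_le[OF h S] by (simp flip: sum_divide_distrib)
      finally obtain l where l: "l < n" "(1/2) ^ J / 2 < \<bar>Re (u * P (x l)) / 4\<bar>"
        using det[of b] neg unfolding eq by auto
      have "\<bar>Re (u * P (x l))\<bar> \<le> cmod (u * P (x l))" by (rule abs_Re_le_cmod)
      also have "\<dots> = cmod (h (x l) - P (x l))" using u zero[OF l(1)] by (simp add: norm_mult)
      also have "\<dots> \<le> 2 * (1/2) ^ J" by (rule tail[OF x[OF l(1)]])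
      finally show False using l(2) by simp
    qed
    have intR: "integrable (cube_measure d) (\<lambda>y. (Re (u * P y) / 4)\<^sup>2)" for u
      by (intro integrable_cube_continuous continuous_intros cP) auto
    have "(LINT y|cube_measure d. (cmod (h y))\<^sup>2) \<le>
      (LINT y|cube_measure d. 32 * ((Re (1 * P y) / 4)\<^sup>2 + (Re (- \<i> * P y) / 4)\<^sup>2) + 8 * (1/4) ^ J)"
    proof (rule integral_mono)
      show "integrable (cube_measure d) (\<lambda>y. (cmod (h y))\<^sup>2)"
        by (intro integrable_cube_continuous continuous_intros ch)
      show "integrable (cube_measure d) (\<lambda>y. 32 * ((Re (1 * P y) / 4)\<^sup>2 + (Re (- \<i> * P y) / 4)\<^sup>2) + 8 * (1/4) ^ J)"
        by (intro Bochner_Integration.integrable_add integrable_mult_right intR) simp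
      fix y assume "y \<in> space (cube_measure d)"
      then have t: "cmod (h y - P y) \<le> 2 * (1/2) ^ J" using tail by simp
      have "(cmod (h y))\<^sup>2 \<le> (cmod (P y) + cmod (h y - P y))\<^sup>2"
        using norm_triangle_ineq[of "P y" "h y - P y"] by (intro power_mono) auto
      also have "\<dots> \<le> 2 * (cmod (P y))\<^sup>2 + 2 * (cmod (h y - P y))\<^sup>2"
        using zero_le_power2[of "cmod (P y) - cmod (h y - P y)"] by (simp add: power2_eq_square algebra_simps)
      also have "(cmod (h y - P y))\<^sup>2 \<le> (2 * (1/2) ^ J)\<^sup>2" using t by (intro power_mono) auto
      also have "(2 * (1/2) ^ J)\<^sup>2 = 4 * (1/4::real) ^ J" by (simp add: power2_eq_square flip: power_mult_distrib)
      also have "2 * (cmod (P y))\<^sup>2 = 32 * ((Re (1 * P y) / 4)\<^sup>2 + (Re (- \<i> * P y) / 4)\<^sup>2)"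
        by (simp add: cmod_power2 power_divide)
      finally show "(cmod (h y))\<^sup>2 \<le> 32 * ((Re (1 * P y) / 4)\<^sup>2 + (Re (- \<i> * P y) / 4)\<^sup>2) + 8 * (1/4) ^ J"
        by simp
    qed
    also have "\<dots> = 32 * ((LINT y|cube_measure d. (Re (1 * P y) / 4)\<^sup>2) + (LINT y|cube_measure d. (Re (- \<i> * P y) / 4)\<^sup>2)) + 8 * (1/4) ^ J"
      using intR[of 1] intR[of "- \<i>"] by (simp add: cube.prob_space[unfolded space_cube_measure])
    also have "\<dots> \<le> 32 * (2 * (1/4) ^ J + 2 * (1/4) ^ J) + 8 * (1/4) ^ J"
      by (intro add_mono mult_left_mono part) auto
    also have "\<dots> \<le> 256 * (1/4) ^ J" by simp
    finally show ?thesis .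
  qed
  with x show ?thesis by blast
qed

text \<open>
  The recovery map returns some member of the class with the given samples, and zero for data that
  no member produces.
\<close>

lemma complexity_le_of_uniqueness_points:
  assumes n: "1 \<le> n" and e: "0 \<le> e" and x: "\<And>l. l < n \<Longrightarrow> x l \<in> unit_cube d"
    and uniq: "\<And>f g. f \<in> F_log d \<Longrightarrow> g \<in> F_log d \<Longrightarrow> (\<And>l. l < n \<Longrightarrow> f (x l) = g (x l)) \<Longrightarrow>
      L2_norm_cube d (\<lambda>y. f y - g y) \<le> e"
  shows "complexity e d (F_log d) \<le> enat n"
proof -
  define Q where "Q y g \<longleftrightarrow> g \<in> F_log d \<and> (\<forall>l<n. g (x l) = y l)" for y g
  define \<phi> where "\<phi> y = (if \<exists>g. Q y g then SOME g. Q y g else (\<lambda>_. 0))" for y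
  define A where "A f = \<phi> (\<lambda>i\<in>{..<n}. f (x i))" for f :: "(nat \<Rightarrow> real) \<Rightarrow> complex"
  have QA: "Q (\<lambda>i\<in>{..<n}. f (x i)) (A f)" if "f \<in> F_log d" for f
  proof -
    have "\<exists>g. Q (\<lambda>i\<in>{..<n}. f (x i)) g" using that by (intro exI[of _ f]) (simp add: Q_def)
    then show ?thesis unfolding A_def \<phi>_def by (simp add: someI_ex)
  qed
  have L2: "g \<in> L2_cube d" if "continuous_on (unit_cube d) g" for g
    unfolding L2_cube_def using that
    by (auto intro!: borel_measurable_cube_continuous integrable_cube_continuous continuous_intros)
  have "\<phi> y \<in> L2_cube d" for y
  proof (cases "\<exists>g. Q y g")
    case True
    then have "Q y (\<phi> y)" unfolding \<phi>_def by (simp add: someI_ex)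
    then show ?thesis by (intro L2) (simp add: Q_def F_log_def)
  next
    case False
    then show ?thesis by (intro L2) (simp add: \<phi>_def)
  qed
  then have "sampling_algorithm d n (F_log d) A"
    unfolding sampling_algorithm_def using x by (intro exI[of _ x] exI[of _ \<phi>]) (auto simp: A_def)
  moreover have "worst_case_error d (F_log d) A \<le> ennreal e"
    unfolding worst_case_error_def
  proof (intro SUP_least ennreal_leI)
    fix f assume f: "f \<in> F_log d"
    show "L2_norm_cube d (\<lambda>y. f y - A f y) \<le> e"
      using QA[OF f] by (intro uniq f) (auto simp: Q_def)
  qed
  ultimately show ?thesis unfolding complexity_def using n by (intro Inf_lower) blast
qed

text \<open>
  The level \<open>J\<close> with \<open>2\<^sup>J \<approx> 16 / \<epsilon>\<close>. The hypothesis \<open>\<epsilon> < 1/2\<close> absorbs the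
  additive constants into \<open>ln (1 / \<epsilon>)\<close>.
\<close>

lemma exists_dyadic_accuracy:
  fixes e :: real
  assumes e: "0 < e" "e < 1/2"
  obtains J :: nat where "5 \<le> J" "16 * (1/2) ^ J \<le> e" "2 ^ J \<le> 32 / e" "real J \<le> 9 * ln (1 / e)"
proof -
  define J where "J = nat \<lceil>log 2 (16 / e)\<rceil>"
  have l5: "5 < log 2 (16 / e)"
  proof -
    have "log 2 (2 ^ 5) < log 2 (16 / e)" using e by (subst log_less_cancel_iff) (auto simp: field_simps)
    moreover have "log 2 ((2::real) ^ 5) = 5" by (subst log_nat_power) auto
    ultimately show ?thesis by simp
  qed
  have J: "log 2 (16 / e) \<le> J" "J < log 2 (16 / e) + 1" unfolding J_def using l5 by linarith+
  have "16 / e = 2 powr log 2 (16 / e)" using e by simp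
  also have "\<dots> \<le> 2 powr J" using J by (intro powr_mono) auto
  finally have 1: "16 / e \<le> 2 ^ J" by (simp add: powr_realpow)
  have "2 powr J \<le> 2 powr (log 2 (16 / e) + 1)" using J by (intro powr_mono) auto
  also have "\<dots> = 32 / e" using e by (simp add: powr_add)
  finally have 2: "2 ^ J \<le> 32 / e" by (simp add: powr_realpow)
  have "real J * ln 2 = ln (2 ^ J)" by (simp add: ln_realpow)
  also have "\<dots> \<le> ln (32 / e)" using 2 e by (subst ln_le_cancel_iff) auto
  also have "\<dots> \<le> ln ((1 / e) ^ 6)"
  proof (subst ln_le_cancel_iff)
    have "2 ^ 5 \<le> (1 / e) ^ 5" using e by (intro power_mono) (auto simp: field_simps)
    then have "2 ^ 5 * (1 / e) \<le> (1 / e) ^ 5 * (1 / e)" using e by (intro mult_right_mono) auto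
    then show "32 / e \<le> (1 / e) ^ 6" by (simp add: power_numeral_reduce mult_ac)
  qed (use e in auto)
  also have "\<dots> = 6 * ln (1 / e)" using e by (subst ln_realpow) auto
  finally have "real J * ln 2 \<le> 6 * ln (1 / e)" .
  moreover have "real J * (2/3) \<le> real J * ln 2" by (intro mult_left_mono ln2_ge_two_thirds) auto
  ultimately have 3: "real J \<le> 9 * ln (1 / e)" by simp
  have "5 \<le> J" using l5 J by linarith
  moreover have "16 * (1/2) ^ J \<le> e" using 1 e by (simp add: field_simps power_divide)
  ultimately show ?thesis using 2 3 that by blast
qed

text \<open>
  A cutoff \<open>m \<approx> exp (2\<^sup>J)\<close>, for which the dictionary has logarithmic size \<open>O(d 2\<^sup>J)\<close>.
\<close>

lemma exists_log_cutoff: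
  assumes J: "5 \<le> J" and d: "1 \<le> d"
  obtains m :: nat where "2 \<le> m" "2 ^ J \<le> ln (real m)" "ln (4 * (2 * real m + 1) ^ d) \<le> 2 * real d * 2 ^ J"
proof -
  define E where "E = exp ((2::real) ^ J)"
  define m where "m = nat \<lceil>E\<rceil>"
  have J32: "32 \<le> (2::real) ^ J" using J power_increasing[of 5 J "2::real"] by simp
  have E2: "2 \<le> E" unfolding E_def using exp_ge_add_one_self[of "(2::real) ^ J"] J32 by linarith
  have m: "E \<le> m" "m \<le> E + 1" unfolding m_def using E2 by linarith+
  have e5: "24 \<le> exp (5::real)"
  proof -
    have "2 ^ 5 \<le> exp (1::real) ^ 5" by (rule power_mono) (use exp_ge_add_one_self[of "1::real"] in auto)
    then show ?thesis by (simp flip: exp_of_nat_mult)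
  qed
  have base: "4 * (2 * real m + 1) \<le> exp (2 * 2 ^ J)"
  proof -
    have "real m \<le> E + 1" by (rule m)
    then have "8 * real m + 4 \<le> 24 * E" using E2 by linarith
    then have "4 * (2 * real m + 1) \<le> 24 * E" by simp
    also have "\<dots> \<le> exp 5 * E" using e5 E2 by (intro mult_right_mono) auto
    also have "\<dots> = exp (5 + 2 ^ J)" by (simp add: E_def exp_add)
    also have "\<dots> \<le> exp (2 * 2 ^ J)" using J32 by simp
    finally show ?thesis .
  qed
  \<comment> \<open>\<open>d \<ge> 1\<close> allows the factor \<open>4\<close> to be moved into the power\<close>
  have "4 * (2 * real m + 1) ^ d \<le> 4 ^ d * (2 * real m + 1) ^ d"
    using d power_increasing[of 1 d "4::real"] by (intro mult_right_mono) auto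
  also have "\<dots> = (4 * (2 * real m + 1)) ^ d" by (simp only: power_mult_distrib)
  also have "\<dots> \<le> exp (2 * 2 ^ J) ^ d" using base by (intro power_mono) auto
  also have "\<dots> = exp (2 * real d * 2 ^ J)" by (simp flip: exp_of_nat_mult add: mult_ac)
  finally have "ln (4 * (2 * real m + 1) ^ d) \<le> ln (exp (2 * real d * 2 ^ J))"
    by (subst ln_le_cancel_iff) (auto intro!: mult_pos_pos zero_less_power add_nonneg_pos)
  moreover have "2 ^ J \<le> ln (real m)"
    using m E2 ln_le_cancel_iff[of E "real m"] by (simp add: E_def)
  moreover have "2 \<le> m" using m E2 by linarith
  ultimately show ?thesis using that by simp
qed

theorem theorem1:
  "\<exists>c::real. c > 0 \<and>
     (\<forall>d::nat. 1 \<le> d \<longrightarrow>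
       (\<forall>\<epsilon>::real. 0 < \<epsilon> \<and> \<epsilon> < 1/2 \<longrightarrow>
         ereal_of_enat (complexity \<epsilon> d (F_log d))
           \<le> ereal (c * real d * (1 / \<epsilon>) ^ 3 * (ln (1 / \<epsilon>)) ^ 3)))"
proof (intro exI[of _ "36864 * 81 * 32768 * (3/2)"] conjI allI impI)
  fix d :: nat and e :: real
  assume d: "1 \<le> d" and e: "0 < e \<and> e < 1/2"
  define L where "L = ln (1 / e)"
  obtain J where J: "5 \<le> J" "16 * (1/2) ^ J \<le> e" "2 ^ J \<le> 32 / e" "real J \<le> 9 * L"
    using exists_dyadic_accuracy[of e] e unfolding L_def by auto
  \<comment> \<open>with \<open>ln m \<ge> 2\<^sup>J\<close> the tail is at most \<open>2 \<cdot> 2\<^bsup>-J\<^esup>\<close>, which after the division by \<open>4\<close> is the detection threshold\<close>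
  obtain m where m: "2 \<le> m" "2 ^ J \<le> ln (real m)" "ln (4 * (2 * real m + 1) ^ d) \<le> 2 * real d * 2 ^ J"
    using exists_log_cutoff[OF J(1) d] by auto
  define n where "n = 36864 * J\<^sup>2 * 8 ^ J * d"
  have n1: "1 \<le> n" using J d by (simp add: n_def)
  have J1: "1 \<le> J" using J by simp
  have "18432 * real J ^ 2 * 4 ^ J * ln (4 * (2 * real m + 1) ^ d) \<le> 18432 * real J ^ 2 * 4 ^ J * (2 * real d * 2 ^ J)"
    by (intro mult_left_mono m) auto
  also have "\<dots> = 36864 * real J ^ 2 * (4 ^ J * 2 ^ J) * d" by simp
  also have "(4::real) ^ J * 2 ^ J = 8 ^ J" by (simp flip: power_mult_distrib)
  finally have "18432 * real J ^ 2 * 4 ^ J * ln (4 * (2 * real m + 1) ^ d) \<le> real n" by (simp add: n_def)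
  from exists_uniqueness_points[OF d J1 m(1,2) this] obtain x where
    x: "\<And>l. l < n \<Longrightarrow> x l \<in> unit_cube d" and
    small: "\<And>h. log_wiener_le d 2 h \<Longrightarrow> (\<And>l. l < n \<Longrightarrow> h (x l) = 0) \<Longrightarrow>
      (LINT y|cube_measure d. (cmod (h y))\<^sup>2) \<le> 256 * (1/4) ^ J"
    by blast
  have "complexity e d (F_log d) \<le> enat n"
  proof (rule complexity_le_of_uniqueness_points[OF n1 _ x])
    fix f g assume f: "f \<in> F_log d" and g: "g \<in> F_log d" and fg: "\<And>l. l < n \<Longrightarrow> f (x l) = g (x l)"
    have "log_wiener_le d 2 (\<lambda>y. f y - g y)"
      using log_wiener_le_diff[OF log_wiener_le_F_log[OF f] log_wiener_le_F_log[OF g]] by simp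
    then have "(LINT y|cube_measure d. (cmod (f y - g y))\<^sup>2) \<le> 256 * (1/4) ^ J"
      by (rule small) (simp add: fg)
    also have "\<dots> = (16 * (1/2) ^ J)\<^sup>2" by (simp add: power2_eq_square flip: power_mult_distrib)
    also have "\<dots> \<le> e\<^sup>2" using J by (intro power_mono) auto
    finally show "L2_norm_cube d (\<lambda>y. f y - g y) \<le> e"
      unfolding L2_norm_cube_def using e by (intro real_le_lsqrt) auto
  qed (use e in auto)
  then have "ereal_of_enat (complexity e d (F_log d)) \<le> ereal_of_enat (enat n)"
    by (simp only: ereal_of_enat_le_iff)
  also have "\<dots> = ereal (real n)" by simp
  also have "\<dots> \<le> ereal (36864 * 81 * 32768 * (3/2) * real d * (1 / e) ^ 3 * L ^ 3)"
  proof -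
    have L: "2/3 \<le> L"
    proof -
      have "ln 2 \<le> ln (1 / e)" using e by (subst ln_le_cancel_iff) (auto simp: field_simps)
      then show ?thesis using ln2_ge_two_thirds by (simp add: L_def)
    qed
    have "(8::real) ^ J = (2 ^ J) ^ 3" using power_mult[of "2::real" 3 J] power_mult[of "2::real" J 3] by (simp add: mult.commute)
    also have "\<dots> \<le> (32 / e) ^ 3" using J by (intro power_mono) auto
    also have "\<dots> = 32768 * (1 / e) ^ 3" by (simp add: power_divide)
    finally have b8: "(8::real) ^ J \<le> 32768 * (1 / e) ^ 3" .
    have "(real J)\<^sup>2 \<le> (9 * L)\<^sup>2" using J by (intro power_mono) auto
    also have "\<dots> = 81 * L\<^sup>2 * 1" by (simp add: power_mult_distrib)
    also have "\<dots> \<le> 81 * L\<^sup>2 * (3/2 * L)" using L by (intro mult_left_mono) auto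
    finally have bJ: "(real J)\<^sup>2 \<le> 81 * (3/2) * L ^ 3" by (simp add: power2_eq_square power3_eq_cube mult_ac)
    have "real n = 36864 * (real J)\<^sup>2 * 8 ^ J * d" by (simp add: n_def)
    also have "\<dots> \<le> 36864 * (81 * (3/2) * L ^ 3) * (32768 * (1 / e) ^ 3) * d"
      using L e by (intro mult_right_mono mult_mono bJ b8) auto
    also have "\<dots> = 36864 * 81 * 32768 * (3/2) * real d * (1 / e) ^ 3 * L ^ 3" by simp
    finally show ?thesis by simp
  qed
  finally show "ereal_of_enat (complexity e d (F_log d)) \<le>
      ereal (36864 * 81 * 32768 * (3/2) * real d * (1 / e) ^ 3 * (ln (1 / e)) ^ 3)"
    by (simp only: L_def)
qed simp

end
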